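(* Let $n\ge1$. The map $P\mapsto\chi_P$ is a bijection from $\mathscr{L}_{\mathrm{Pell}}(n,\mathbb{F}_q)$ to the set of Heisenberg supercharacters of $\mathbf{U}_n(\mathbb{F}_q)$ (supercharacters that are Heisenberg characters). Consequently the number of Heisenberg supercharacters of $\mathbf{U}_n(\mathbb{F}_q)$ is $\mathcal{D}_n(q-1)$.
   Context: $\mathfrak{n}=\mathfrak{u}_n(\mathbb{F}_q)$ (strictly upper triangular $n\times n$ matrices), $G=\mathbf{U}_n(\mathbb{F}_q)=1+\mathfrak n$; $e^*_{ij}\in\mathfrak n^*$ is $X\mapsto X_{ij}$. A Heisenberg character is an irreducible character whose kernel contains $[G,[G,G]]$. Fix a nontrivial homomorphism $\theta:\mathbb F_q^+\to\mathbb C^\times$; for $\lambda\in\mathfrak n^*$, $\theta_\lambda(1+X)=\theta(\lambda(X))$; $G$ acts on $\mathfrak n^*$ by $(g\lambda)(X)=\lambda(g^{-1}X)$, $(\lambda g)(X)=\lambda(Xg^{-1})$, with left and two-sided orbits $G\lambda$, $G\lambda G$; the supercharacter is $\chi_\lambda=\frac{|G\lambda|}{|G\lambda G|}\sum_{\mu\in G\lambda G}\theta_\mu$, and the supercharacters of $G$ are the $\chi_\lambda$, $\lambda\in\mathfrak n^*$. A lattice path with steps in $S\subseteq\mathbb N^2$ is a finite sequence of elements of $S$ starting at $(0,0)$; an $\mathbb F_q$-labeled path assigns to each step $(i,j)$ a sequence of $j$ labels in $\mathbb F_q^\times$. Write $\to,\nearrow,\uparrow$ for steps $(1,0),(1,1),(0,1)$,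 labels as subscripts. $\mathscr L_{\mathrm{Pell}}(n,\mathbb F_q)$ is the set of labeled paths with steps in $\{(1,0),(1,1),(0,1)\}$ ending on the line $x+y=n-1$. For $P=(s_1,\dots,s_\ell)$ in this set, let $d_k(P)$ be the coordinate sum of the start of $s_k$ and $i=d_k(P)+1$; $\lambda_{P,k}=0$ if $s_k=\to$, $te^*_{i,i+1}$ if $s_k=\uparrow_t$, $te^*_{i,i+2}$ if $s_k=\nearrow_t$; $\lambda_P=\sum_k\lambda_{P,k}$ and $\chi_P=\chi_{\lambda_P}$. $D(a,b)$ (Delannoy number) is the number of unlabeled lattice paths from $(0,0)$ to $(a,b)$ with steps in $\{(1,0),(1,1),(0,1)\}$, and $\mathcal D_{m+1}(x)=\sum_{k=0}^mD(m-k,k)x^k$ for $m\ge0$. *)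

theory Defs
  imports
    "HOL-Algebra.Generated_Groups"
    "HOL-Library.FuncSet"
    "HOL-Library.Cardinality"
    "HOL-Computational_Algebra.Polynomial"
    "Jordan_Normal_Form.VS_Connect"
begin

text \<open>
  Functions on a group or on a vector space are represented as extensional functions (they are
  \<open>undefined\<close> outside the carrier), so that HOL equality, and hence cardinality of sets of
  functions, agrees with equality on the carrier.
\<close>

subsection \<open>Irreducible characters of a finite group\<close>

definition GL :: "nat \<Rightarrow> complex mat monoid" where
  "GL d = units_of (ring_mat TYPE(complex) d ())"

definition mat_trace :: "'a::comm_monoid_add mat \<Rightarrow> 'a" where
  "mat_trace A = (\<Sum>i<dim_row A. A $$ (i, i))"

definition irreducible_representation ::
  "('g, 'm) monoid_scheme \<Rightarrow> nat \<Rightarrow> ('g \<Rightarrow> complex mat) \<Rightarrow> bool" where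
  "irreducible_representation G d \<rho> \<longleftrightarrow>
     \<rho> \<in> hom G (GL d) \<and> d > 0 \<and>
     (\<forall>W. subspace class_ring W (module_vec TYPE(complex) d) \<and>
          (\<forall>g\<in>carrier G. \<forall>w\<in>W. \<rho> g *\<^sub>v w \<in> W) \<longrightarrow>
          W = {0\<^sub>v d} \<or> W = carrier_vec d)"

definition irreducible_characters :: "('g, 'm) monoid_scheme \<Rightarrow> ('g \<Rightarrow> complex) set" where
  "irreducible_characters G =
     {restrict (\<lambda>g. mat_trace (\<rho> g)) (carrier G) | d \<rho>. irreducible_representation G d \<rho>}"

definition char_kernel :: "('g, 'm) monoid_scheme \<Rightarrow> ('g \<Rightarrow> complex) \<Rightarrow> 'g set" where
  "char_kernel G \<chi> = {g \<in> carrier G. \<chi> g = \<chi> \<one>\<^bsub>G\<^esub>}"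

definition commutator_subgroup ::
  "('g, 'm) monoid_scheme \<Rightarrow> 'g set \<Rightarrow> 'g set \<Rightarrow> 'g set" where
  "commutator_subgroup G H K =
     generate G {h \<otimes>\<^bsub>G\<^esub> k \<otimes>\<^bsub>G\<^esub> inv\<^bsub>G\<^esub> h \<otimes>\<^bsub>G\<^esub> inv\<^bsub>G\<^esub> k | h k. h \<in> H \<and> k \<in> K}"

definition Heisenberg_characters :: "('g, 'm) monoid_scheme \<Rightarrow> ('g \<Rightarrow> complex) set" where
  "Heisenberg_characters G =
     {\<chi> \<in> irreducible_characters G.
        commutator_subgroup G (carrier G) (commutator_subgroup G (carrier G) (carrier G))
          \<subseteq> char_kernel G \<chi>}"

subsection \<open>The unitriangular group and its supercharacters\<close>

definition strictly_upper :: "nat \<Rightarrow> 'a::zero mat set" where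
  "strictly_upper n =
     {X \<in> carrier_mat n n. \<forall>i<n. \<forall>j<n. j \<le> i \<longrightarrow> X $$ (i, j) = 0}"

definition unitri :: "nat \<Rightarrow> 'a::field mat monoid" where
  "unitri n = \<lparr>carrier = {1\<^sub>m n + X | X. X \<in> strictly_upper n}, mult = (*), one = 1\<^sub>m n\<rparr>"

text \<open>The dual space of \<^term>\<open>strictly_upper n\<close>: extensional linear functionals.\<close>

definition dual :: "nat \<Rightarrow> ('a::field mat \<Rightarrow> 'a) set" where
  "dual n = {l \<in> extensional (strictly_upper n).
     (\<forall>X\<in>strictly_upper n. \<forall>Y\<in>strictly_upper n. l (X + Y) = l X + l Y) \<and>
     (\<forall>c. \<forall>X\<in>strictly_upper n. l (c \<cdot>\<^sub>m X) = c * l X)}"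

definition left_act :: "nat \<Rightarrow> 'a::field mat \<Rightarrow> ('a mat \<Rightarrow> 'a) \<Rightarrow> 'a mat \<Rightarrow> 'a" where
  "left_act n g l = restrict (\<lambda>X. l (inv\<^bsub>unitri n\<^esub> g * X)) (strictly_upper n)"

definition right_act :: "nat \<Rightarrow> ('a::field mat \<Rightarrow> 'a) \<Rightarrow> 'a mat \<Rightarrow> 'a mat \<Rightarrow> 'a" where
  "right_act n l g = restrict (\<lambda>X. l (X * inv\<^bsub>unitri n\<^esub> g)) (strictly_upper n)"

definition left_orbit :: "nat \<Rightarrow> ('a::field mat \<Rightarrow> 'a) \<Rightarrow> ('a mat \<Rightarrow> 'a) set" where
  "left_orbit n l = {left_act n g l | g. g \<in> carrier (unitri n)}"

definition two_sided_orbit :: "nat \<Rightarrow> ('a::field mat \<Rightarrow> 'a) \<Rightarrow> ('a mat \<Rightarrow> 'a) set" where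
  "two_sided_orbit n l =
     {right_act n (left_act n g l) h | g h. g \<in> carrier (unitri n) \<and> h \<in> carrier (unitri n)}"

definition nontrivial_additive_character :: "('a::field \<Rightarrow> complex) \<Rightarrow> bool" where
  "nontrivial_additive_character \<theta> \<longleftrightarrow>
     (\<forall>x y. \<theta> (x + y) = \<theta> x * \<theta> y) \<and> (\<forall>x. \<theta> x \<noteq> 0) \<and> (\<exists>x. \<theta> x \<noteq> 1)"

definition theta_fun ::
  "('a::field \<Rightarrow> complex) \<Rightarrow> nat \<Rightarrow> ('a mat \<Rightarrow> 'a) \<Rightarrow> 'a mat \<Rightarrow> complex" where
  "theta_fun \<theta> n l g = \<theta> (l (g - 1\<^sub>m n))"

definition supercharacter ::
  "('a::field \<Rightarrow> complex) \<Rightarrow> nat \<Rightarrow> ('a mat \<Rightarrow> 'a) \<Rightarrow> 'a mat \<Rightarrow> complex" where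
  "supercharacter \<theta> n l =
     restrict (\<lambda>g. of_nat (card (left_orbit n l)) / of_nat (card (two_sided_orbit n l)) *
                     (\<Sum>m\<in>two_sided_orbit n l. theta_fun \<theta> n m g))
              (carrier (unitri n))"

definition supercharacters :: "('a::field \<Rightarrow> complex) \<Rightarrow> nat \<Rightarrow> ('a mat \<Rightarrow> complex) set" where
  "supercharacters \<theta> n = supercharacter \<theta> n ` dual n"

definition Heisenberg_supercharacters ::
  "('a::field \<Rightarrow> complex) \<Rightarrow> nat \<Rightarrow> ('a mat \<Rightarrow> complex) set" where
  "Heisenberg_supercharacters \<theta> n = supercharacters \<theta> n \<inter> Heisenberg_characters (unitri n)"

subsection \<open>Lattice paths\<close>

type_synonym step = "nat \<times> nat"

text \<open>A path is the list of its steps; it starts at \<^term>\<open>(0, 0)\<close>.\<close>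

definition endpoint :: "step list \<Rightarrow> nat \<times> nat" where
  "endpoint p = (\<Sum>s\<leftarrow>p. fst s, \<Sum>s\<leftarrow>p. snd s)"

definition lattice_paths :: "step set \<Rightarrow> step list set" where
  "lattice_paths S = {p. set p \<subseteq> S}"

text \<open>In a labeled path, every step comes with its sequence of labels.\<close>

type_synonym 'a labeled_path = "(step \<times> 'a list) list"

definition labeled_paths :: "step set \<Rightarrow> 'a::zero labeled_path set" where
  "labeled_paths S =
     {P. map fst P \<in> lattice_paths S \<and>
         (\<forall>(s, ts)\<in>set P. length ts = snd s \<and> 0 \<notin> set ts)}"

definition Pell_steps :: "step set" where
  "Pell_steps = {(1, 0), (1, 1), (0, 1)}"

definition Pell_paths :: "nat \<Rightarrow> 'a::zero labeled_path set" where
  "Pell_paths n =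
     {P \<in> labeled_paths Pell_steps.
        (case endpoint (map fst P) of (x, y) \<Rightarrow> int x + int y = int n - 1)}"

definition start_sum :: "'a labeled_path \<Rightarrow> nat \<Rightarrow> nat" where
  "start_sum P k = (case endpoint (map fst (take k P)) of (x, y) \<Rightarrow> x + y)"

text \<open>
  Matrix entries are indexed from \<open>0\<close>, so the functional usually written e*_{ij} is
  \<open>entry_functional n (i - 1) (j - 1)\<close>. Similarly steps are numbered from \<open>0\<close>, so \<open>start_sum P k\<close>
  is the coordinate sum \<open>d\<close> of the start of the step, and \<open>i = d + 1\<close> becomes the index \<open>d\<close>.
\<close>

definition entry_functional :: "nat \<Rightarrow> nat \<Rightarrow> nat \<Rightarrow> 'a::zero mat \<Rightarrow> 'a" where
  "entry_functional n i j = restrict (\<lambda>X. X $$ (i, j)) (strictly_upper n)"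

definition step_functional :: "nat \<Rightarrow> 'a::field labeled_path \<Rightarrow> nat \<Rightarrow> 'a mat \<Rightarrow> 'a" where
  "step_functional n P k =
     (let (s, ts) = P ! k; d = start_sum P k in
      restrict
        (\<lambda>X. if s = (0, 1) then hd ts * entry_functional n d (d + 1) X
             else if s = (1, 1) then hd ts * entry_functional n d (d + 2) X
             else 0)
        (strictly_upper n))"

definition path_functional :: "nat \<Rightarrow> 'a::field labeled_path \<Rightarrow> 'a mat \<Rightarrow> 'a" where
  "path_functional n P =
     restrict (\<lambda>X. \<Sum>k<length P. step_functional n P k X) (strictly_upper n)"

definition path_character ::
  "('a::field \<Rightarrow> complex) \<Rightarrow> nat \<Rightarrow> 'a labeled_path \<Rightarrow> 'a mat \<Rightarrow> complex" where
  "path_character \<theta> n P = supercharacter \<theta> n (path_functional n P)"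

subsection \<open>Delannoy numbers\<close>

definition Delannoy :: "nat \<Rightarrow> nat \<Rightarrow> nat" where
  "Delannoy a b = card {p \<in> lattice_paths Pell_steps. endpoint p = (a, b)}"

text \<open>For \<open>n = m + 1\<close> the index \<open>k\<close> ranges over \<open>0, \<dots>, m\<close>.\<close>

definition Delannoy_poly :: "nat \<Rightarrow> int poly" where
  "Delannoy_poly n = (\<Sum>k<n. monom (int (Delannoy (n - 1 - k) k)) k)"

end

theory Submission
  imports Defs "Jordan_Normal_Form.Spectral_Radius"
begin

text \<open>
  The third term of the lower central series consists of the matrices \<open>1 + X\<close> with \<open>X\<close> vanishing on
  the first two superdiagonals. It lies in the kernel of \<open>\<chi>\<^sub>\<lambda>\<close> iff every functional in the orbit of
  \<open>\<lambda>\<close> vanishes on such \<open>X\<close>, that is, iff \<open>\<lambda>\<close> is given by coefficients \<open>a\<^sub>i\<close> at \<open>(i, i + 1)\<close> and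
  \<open>b\<^sub>i\<close> at \<open>(i, i + 2)\<close>. Acting from the left (right) changes exactly the \<open>a\<^sub>i\<close> with
  \<open>b\<^sub>i\<^sub>-\<^sub>1 \<noteq> 0\<close> (\<open>b\<^sub>i \<noteq> 0\<close>), freely. So if \<open>S\<close> is the support of \<open>b\<close> and \<open>F = S \<union> (S + 1)\<close>, then
  \<open>\<chi>\<^sub>\<lambda>\<close> is supported on the matrices whose first superdiagonal vanishes on \<open>F\<close>, where it equals
  \<open>q^|S| \<theta>\<^sub>\<lambda>\<close>; in particular the \<open>a\<^sub>i\<close> with \<open>i \<in> F\<close> are irrelevant and the other coefficients are
  determined by \<open>\<chi>\<^sub>\<lambda>\<close>.

  If \<open>\<chi>\<^sub>\<lambda>\<close> is irreducible, then Schur orthogonality gives \<open>q^(2|S|) = q^|F|\<close>, so \<open>S\<close> has no two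
  adjacent elements. Conversely, for such \<open>S\<close> the group acts irreducibly on the functions on
  \<open>F_q^S\<close> by translations and multiplications with characters, and the trace of this action is
  \<open>\<chi>\<^sub>\<lambda>\<close>. The pairs \<open>(a, b)\<close> with \<open>S\<close> free of adjacent elements and \<open>a\<close> vanishing on \<open>F\<close> are read off
  from the labels of a unique path.
\<close>

section \<open>Labeled paths and their labels\<close>

text \<open>Models the vector space of functions on \<open>T\<close> by total functions vanishing
  elsewhere, so that functions with different index sets can be added pointwise and have their
  arguments shifted.\<close>

definition supp_funs :: "nat set \<Rightarrow> (nat \<Rightarrow> 'a::zero) set" where
  "supp_funs T = {f. \<forall>i. i \<notin> T \<longrightarrow> f i = 0}"

fun path_height :: "'a labeled_path \<Rightarrow> nat" where
  "path_height [] = 0"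
| "path_height ((s, ts) # P) = fst s + snd s + path_height P"

text \<open>
  The coefficients of \<open>e*\<close> at \<open>(j, j + 1)\<close> and at \<open>(j, j + 2)\<close> in the functional of a path. A diagonal
  step at \<open>j\<close> also uses up the coordinate \<open>j + 1\<close>, so no step starts there.
\<close>

fun short_labels :: "'a::zero labeled_path \<Rightarrow> nat \<Rightarrow> 'a" where
  "short_labels [] j = 0"
| "short_labels ((s, ts) # P) j =
     (if j < fst s + snd s then (if j = 0 \<and> s = (0, 1) then hd ts else 0)
      else short_labels P (j - (fst s + snd s)))"

fun long_labels :: "'a::zero labeled_path \<Rightarrow> nat \<Rightarrow> 'a" where
  "long_labels [] j = 0"
| "long_labels ((s, ts) # P) j =
     (if j < fst s + snd s then (if j = 0 \<and> s = (1, 1) then hd ts else 0)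
      else long_labels P (j - (fst s + snd s)))"

text \<open>Normal forms for the coefficients on the two superdiagonals, with \<open>m\<close> in
  the role of n - 1: the second superdiagonal has one position fewer, and a nonzero
  \<open>b i\<close> occupies the positions i and i + 1, which admit no further label.\<close>

definition label_pairs :: "nat \<Rightarrow> ((nat \<Rightarrow> 'a::zero) \<times> (nat \<Rightarrow> 'a)) set" where
  "label_pairs m = {(a, b). a \<in> supp_funs {..<m} \<and> b \<in> supp_funs {..<m - 1} \<and>
     (\<forall>i. b i \<noteq> 0 \<longrightarrow> a i = 0 \<and> a (Suc i) = 0 \<and> b (Suc i) = 0)}"

section \<open>Correspondence between labeled paths and label pairs\<close>

lemma labeled_paths_Nil [simp]: "[] \<in> labeled_paths S"
  by (simp add: labeled_paths_def lattice_paths_def)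

lemma labeled_paths_Cons [simp]:
  "(s, ts) # P \<in> labeled_paths S \<longleftrightarrow>
     s \<in> S \<and> length ts = snd s \<and> 0 \<notin> set ts \<and> P \<in> labeled_paths S"
  by (auto simp: labeled_paths_def lattice_paths_def)

lemma path_height_eq: "(case endpoint (map fst P) of (x, y) \<Rightarrow> x + y) = path_height P"
  by (induction P rule: path_height.induct) (auto simp: endpoint_def)

lemma Pell_paths_eq:
  assumes "n \<ge> 1"
  shows "Pell_paths n = {P \<in> labeled_paths Pell_steps. path_height P = n - 1}"
  using assms by (auto simp: Pell_paths_def simp flip: path_height_eq split: prod.splits)

lemma Pell_step_cases [consumes 1, case_names Nil right diagonal up]:
  assumes "P \<in> labeled_paths Pell_steps"
  obtains "P = []"
  | P' where "P = ((1, 0), []) # P'" "P' \<in> labeled_paths Pell_steps"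
  | t P' where "P = ((1, 1), [t]) # P'" "t \<noteq> 0" "P' \<in> labeled_paths Pell_steps"
  | t P' where "P = ((0, 1), [t]) # P'" "t \<noteq> 0" "P' \<in> labeled_paths Pell_steps"
proof (cases P)
  case (Cons c P')
  obtain s ts where c: "c = (s, ts)" by (cases c)
  have *: "s \<in> Pell_steps" "length ts = snd s" "0 \<notin> set ts" "P' \<in> labeled_paths Pell_steps"
    using assms by (simp_all add: Cons c)
  from *(1) consider "s = (1, 0)" | "s = (1, 1)" | "s = (0, 1)"
    by (auto simp: Pell_steps_def)
  then show ?thesis
  proof cases
    case 1
    with * show ?thesis by (intro that(2)[of P']) (simp_all add: Cons c)
  next
    case 2
    with * obtain t where "ts = [t]" by (auto simp: length_Suc_conv)
    with 2 * show ?thesis by (intro that(3)[of t P']) (simp_all add: Cons c)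
  next
    case 3
    with * obtain t where "ts = [t]" by (auto simp: length_Suc_conv)
    with 3 * show ?thesis by (intro that(4)[of t P']) (simp_all add: Cons c)
  qed
qed (use that(1) in simp)

lemma Pell_paths_induct [consumes 1, case_names Nil right diagonal up]:
  assumes "P \<in> labeled_paths Pell_steps"
    and "Q []"
    and "\<And>P. P \<in> labeled_paths Pell_steps \<Longrightarrow> Q P \<Longrightarrow> Q (((1, 0), []) # P)"
    and "\<And>t P. t \<noteq> 0 \<Longrightarrow> P \<in> labeled_paths Pell_steps \<Longrightarrow> Q P \<Longrightarrow> Q (((1, 1), [t]) # P)"
    and "\<And>t P. t \<noteq> 0 \<Longrightarrow> P \<in> labeled_paths Pell_steps \<Longrightarrow> Q P \<Longrightarrow> Q (((0, 1), [t]) # P)"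
  shows "Q P"
  using assms(1)
proof (induction P rule: length_induct)
  case (1 P)
  from 1(2) show ?case
    by (cases rule: Pell_step_cases) (use 1 assms(2-) in simp_all)
qed

lemma label_pairs_of_path:
  assumes "P \<in> labeled_paths Pell_steps"
  shows "(short_labels P, long_labels P) \<in> label_pairs (path_height P)"
  using assms
proof (induction P rule: Pell_paths_induct)
  case (right P)
  then show ?case
    by (auto simp: label_pairs_def supp_funs_def less_Suc_eq_0_disj Suc_diff_le not_less)
next
  case (diagonal t P)
  \<comment> \<open>A case split on the index replaces the comparison with the step height 2, so
    that the two consumed positions are treated separately.\<close>
  have "short_labels (((1, 1), [t]) # P) i =
      (case i of 0 \<Rightarrow> 0 | Suc 0 \<Rightarrow> 0 | Suc (Suc j) \<Rightarrow> short_labels P j)"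
    and "long_labels (((1, 1), [t]) # P) i =
      (case i of 0 \<Rightarrow> t | Suc 0 \<Rightarrow> 0 | Suc (Suc j) \<Rightarrow> long_labels P j)" for i
    by (auto split: nat.split)
  with diagonal show ?case
    by (auto simp: label_pairs_def supp_funs_def simp del: short_labels.simps long_labels.simps
        split: nat.splits)
next
  case (up t P)
  then show ?case
    by (auto simp: label_pairs_def supp_funs_def less_Suc_eq_0_disj Suc_diff_le not_less)
qed (auto simp: label_pairs_def supp_funs_def)

text \<open>The labels at 0 determine the first step of a nonempty path: a nonzero long label means
  diagonal, a nonzero short label means up, two zeros mean horizontal. Horizontal steps at the end
  of a path leave no trace in the labels, hence the condition on the heights.\<close>

lemma path_eq_if_labels_eq:
  assumes "P \<in> labeled_paths Pell_steps" "Q \<in> labeled_paths Pell_steps"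
    and "path_height P = path_height Q"
    and "short_labels P = short_labels Q" "long_labels P = long_labels Q"
  shows "P = Q"
  using assms
proof (induction P arbitrary: Q rule: Pell_paths_induct)
  case Nil
  from Nil(1) show ?case
    by (cases rule: Pell_step_cases) (use Nil in auto)
next
  case (right P)
  have shift: "short_labels P j = short_labels Q (Suc j)" "long_labels P j = long_labels Q (Suc j)"
    "short_labels Q 0 = 0" "long_labels Q 0 = 0" for j
    using fun_cong[OF right(5), of "Suc j"] fun_cong[OF right(6), of "Suc j"]
      fun_cong[OF right(5), of 0] fun_cong[OF right(6), of 0] by auto
  from right(3) show ?case
    by (cases rule: Pell_step_cases) (use right(2,4) shift in \<open>auto simp: fun_eq_iff\<close>)
next
  case (diagonal t P)
  have shift: "short_labels P j = short_labels Q (Suc (Suc j))"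
    "long_labels P j = long_labels Q (Suc (Suc j))"
    "long_labels Q 0 = t" for j
    using fun_cong[OF diagonal(6), of "Suc (Suc j)"] fun_cong[OF diagonal(7), of "Suc (Suc j)"]
      fun_cong[OF diagonal(7), of 0] by auto
  from diagonal(4) show ?case
    by (cases rule: Pell_step_cases) (use diagonal(1,3,5) shift in \<open>auto simp: fun_eq_iff\<close>)
next
  case (up t P)
  have shift: "short_labels P j = short_labels Q (Suc j)" "long_labels P j = long_labels Q (Suc j)"
    "short_labels Q 0 = t" for j
    using fun_cong[OF up(6), of "Suc j"] fun_cong[OF up(7), of "Suc j"]
      fun_cong[OF up(6), of 0] by auto
  from up(4) show ?case
    by (cases rule: Pell_step_cases) (use up(1,3,5) shift in \<open>auto simp: fun_eq_iff\<close>)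
qed

text \<open>The path is read off from the left: a nonzero \<open>b 0\<close> gives a diagonal step,
  a nonzero \<open>a 0\<close> an up step, and otherwise the step is horizontal. The induction
  continues with the pair shifted by the height of that step.\<close>

lemma path_of_label_pairs:
  assumes "(a, b) \<in> label_pairs m"
  shows "\<exists>P\<in>labeled_paths Pell_steps. path_height P = m \<and> short_labels P = a \<and> long_labels P = b"
  using assms
proof (induction m arbitrary: a b rule: less_induct)
  case (less m)
  define sh :: "nat \<Rightarrow> (nat \<Rightarrow> 'a) \<Rightarrow> nat \<Rightarrow> 'a" where "sh k f = (\<lambda>i. f (i + k))" for k f
  have L: "\<And>i. i \<ge> m \<Longrightarrow> a i = 0" "\<And>i. i \<ge> m - 1 \<Longrightarrow> b i = 0"
    "\<And>i. b i \<noteq> 0 \<Longrightarrow> a i = 0 \<and> a (Suc i) = 0 \<and> b (Suc i) = 0"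
    using less.prems by (auto simp: label_pairs_def supp_funs_def)
  have sh: "(sh k a, sh k b) \<in> label_pairs (m - k)" for k
    using L by (auto simp: sh_def label_pairs_def supp_funs_def)
  consider "m = 0" | "m \<noteq> 0" "b 0 \<noteq> 0" | "m \<noteq> 0" "b 0 = 0" "a 0 \<noteq> 0" | "m \<noteq> 0" "b 0 = 0" "a 0 = 0"
    by blast
  then show ?case
  proof cases
    case 1
    then have "a = short_labels []" "b = long_labels []"
      using L by (auto simp: fun_eq_iff)
    then show ?thesis using 1 by (intro bexI[of _ "[]"]) auto
  next
    case 2
    \<comment> \<open>\<open>b\<close> is supported below \<open>m - 1\<close>, so a nonzero
      \<open>b 0\<close> guarantees room for a step of height two.\<close>
    have "m \<ge> 2" using L(2)[of 0] 2 by (cases "m \<ge> 2") auto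
    then obtain P where "P \<in> labeled_paths Pell_steps" "path_height P = m - 2"
      "short_labels P = sh 2 a" "long_labels P = sh 2 b"
      using less.IH[OF _ sh[of 2]] by auto
    then show ?thesis using 2 L(3)[of 0] \<open>m \<ge> 2\<close>
      by (intro bexI[of _ "((1, 1), [b 0]) # P"])
        (auto simp: fun_eq_iff sh_def Pell_steps_def less_Suc_eq not_less Suc_diff_Suc)
  next
    case 3
    then obtain P where "P \<in> labeled_paths Pell_steps" "path_height P = m - 1"
      "short_labels P = sh 1 a" "long_labels P = sh 1 b"
      using less.IH[OF _ sh[of 1]] by auto
    then show ?thesis using 3
      by (intro bexI[of _ "((0, 1), [a 0]) # P"]) (auto simp: fun_eq_iff sh_def Pell_steps_def)
  next
    case 4
    then obtain P where "P \<in> labeled_paths Pell_steps" "path_height P = m - 1"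
      "short_labels P = sh 1 a" "long_labels P = sh 1 b"
      using less.IH[OF _ sh[of 1]] by auto
    then show ?thesis using 4
      by (intro bexI[of _ "((1, 0), []) # P"]) (auto simp: fun_eq_iff sh_def Pell_steps_def)
  qed
qed

lemma bij_betw_labels:
  assumes "n \<ge> 1"
  shows "bij_betw (\<lambda>P. (short_labels P, long_labels P)) (Pell_paths n) (label_pairs (n - 1))"
  unfolding bij_betw_def Pell_paths_eq[OF assms]
proof (intro conjI)
  show "inj_on (\<lambda>P. (short_labels P, long_labels P))
          {P \<in> labeled_paths Pell_steps. path_height P = n - 1}"
    by (auto intro!: inj_onI path_eq_if_labels_eq)
  show "(\<lambda>P. (short_labels P, long_labels P)) `
          {P \<in> labeled_paths Pell_steps. path_height P = n - 1} = label_pairs (n - 1)"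
  proof (intro equalityI subsetI)
    fix c assume "c \<in> label_pairs (n - 1)"
    then obtain P where "P \<in> labeled_paths Pell_steps" "path_height P = n - 1"
      "short_labels P = fst c" "long_labels P = snd c"
      using path_of_label_pairs[of "fst c" "snd c" "n - 1"] by auto
    then show "c \<in> (\<lambda>P. (short_labels P, long_labels P)) `
        {P \<in> labeled_paths Pell_steps. path_height P = n - 1}"
      by (intro image_eqI[of _ _ P]) auto
  qed (use label_pairs_of_path in force)
qed

section \<open>Enumeration of labeled paths\<close>

lemma card_labelings:
  fixes p :: "step list"
  shows "finite {P :: 'a::{zero,finite} labeled_path.
      map fst P = p \<and> (\<forall>(s, ts)\<in>set P. length ts = snd s \<and> 0 \<notin> set ts)} \<and>
    card {P :: 'a labeled_path.
      map fst P = p \<and> (\<forall>(s, ts)\<in>set P. length ts = snd s \<and> 0 \<notin> set ts)} =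
    (CARD('a) - 1) ^ snd (endpoint p)"
proof (induction p)
  case Nil
  have "{P :: 'a labeled_path.
      map fst P = [] \<and> (\<forall>(s, ts)\<in>set P. length ts = snd s \<and> 0 \<notin> set ts)} = {[]}" by auto
  then show ?case by (simp add: endpoint_def)
next
  case (Cons s p)
  \<comment> \<open>The labels of the first step and those of the remaining path are chosen
    independently. Each label has q - 1 values, and the numbers of labels add up to the second
    coordinate of the endpoint.\<close>
  define A where "A = {ts. set ts \<subseteq> - {0 :: 'a} \<and> length ts = snd s}"
  define B where "B = {P :: 'a labeled_path.
      map fst P = p \<and> (\<forall>(s, ts)\<in>set P. length ts = snd s \<and> 0 \<notin> set ts)}"
  have A: "finite A" "card A = (CARD('a) - 1) ^ snd s"
    unfolding A_def
    by (auto intro!: finite_lists_length_eq simp: card_lists_length_eq card_Diff_singleton Compl_eq_Diff_UNIV)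
  have eq: "{P :: 'a labeled_path.
      map fst P = s # p \<and> (\<forall>(s, ts)\<in>set P. length ts = snd s \<and> 0 \<notin> set ts)} =
      (\<lambda>(ts, P). (s, ts) # P) ` (A \<times> B)"
    by (auto simp: A_def B_def image_iff map_eq_Cons_conv split_def prod_eq_iff Bex_def)
  have inj: "inj_on (\<lambda>(ts, P). (s, ts) # P) (A \<times> B)"
    by (auto intro!: inj_onI)
  show ?case
    unfolding eq card_image[OF inj] using Cons A
    by (simp add: card_cartesian_product B_def endpoint_def power_add)
qed

text \<open>Every step has coordinate sum at least 1, which bounds the length of the path.\<close>

lemma finite_lattice_paths_to: "finite {p \<in> lattice_paths Pell_steps. endpoint p = (x, y)}"
proof (rule finite_subset)
  have "length p \<le> fst (endpoint p) + snd (endpoint p)" if "set p \<subseteq> Pell_steps" for p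
    using that by (induction p) (auto simp: endpoint_def Pell_steps_def)
  then show "{p \<in> lattice_paths Pell_steps. endpoint p = (x, y)} \<subseteq>
      {p. set p \<subseteq> Pell_steps \<and> length p \<le> x + y}"
    by (fastforce simp: lattice_paths_def)
  show "finite {p. set p \<subseteq> Pell_steps \<and> length p \<le> x + y}"
    by (intro finite_lists_length_le) (simp add: Pell_steps_def)
qed

text \<open>The paths are sorted by the second coordinate \<open>k\<close> of the endpoint and then
  by the underlying unlabeled path; each fibre has (q - 1)^k elements.\<close>

lemma card_Pell_paths:
  assumes "n \<ge> 1"
  shows "int (card (Pell_paths n :: 'a::{zero,finite} labeled_path set)) =
    poly (Delannoy_poly n) (int CARD('a) - 1)"
proof -
  define fib where "fib p = {P :: 'a labeled_path.
      map fst P = p \<and> (\<forall>(s, ts)\<in>set P. length ts = snd s \<and> 0 \<notin> set ts)}" for p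
  define U where "U k = {p \<in> lattice_paths Pell_steps. endpoint p = (n - 1 - k, k)}" for k
  have fib: "finite (fib p)" "card (fib p) = (CARD('a) - 1) ^ snd (endpoint p)" for p
    using card_labelings[of p, where 'a='a] by (auto simp: fib_def)
  have fin: "finite (U k)" for k
    unfolding U_def by (rule finite_lattice_paths_to)
  have "Pell_paths n = (\<Union>k<n. \<Union>p\<in>U k. fib p)"
  proof (intro equalityI subsetI)
    fix P :: "'a labeled_path" assume "P \<in> Pell_paths n"
    then show "P \<in> (\<Union>k<n. \<Union>p\<in>U k. fib p)"
      using assms
      by (intro UN_I[of "snd (endpoint (map fst P))"] UN_I[of "map fst P"])
        (auto simp: Pell_paths_def U_def fib_def labeled_paths_def split: prod.splits)
  next
    fix P assume "P \<in> (\<Union>k<n. \<Union>p\<in>U k. fib p)"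
    then show "P \<in> Pell_paths n"
      by (auto simp: Pell_paths_def U_def fib_def labeled_paths_def)
  qed
  also have "card \<dots> = (\<Sum>k<n. card (\<Union>p\<in>U k. fib p))"
  proof (intro card_UN_disjoint ballI impI)
    fix j k :: nat assume "j \<noteq> k"
    then have "p \<noteq> r" if "p \<in> U j" "r \<in> U k" for p r
      using that by (auto simp: U_def)
    then show "(\<Union>p\<in>U j. fib p) \<inter> (\<Union>p\<in>U k. fib p) = {}"
      by (auto simp: fib_def)
  qed (simp_all add: fin fib(1))
  also have "\<dots> = (\<Sum>k<n. Delannoy (n - 1 - k) k * (CARD('a) - 1) ^ k)"
  proof (rule sum.cong[OF refl])
    fix k
    have "card (\<Union>p\<in>U k. fib p) = (\<Sum>p\<in>U k. card (fib p))"
      by (intro card_UN_disjoint) (auto simp: fin fib(1), auto simp: fib_def)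
    also have "\<dots> = (\<Sum>p\<in>U k. (CARD('a) - 1) ^ k)"
      by (intro sum.cong) (auto simp: fib(2) U_def)
    also have "\<dots> = Delannoy (n - 1 - k) k * (CARD('a) - 1) ^ k"
      by (simp add: U_def Delannoy_def)
    finally show "card (\<Union>p\<in>U k. fib p) = Delannoy (n - 1 - k) k * (CARD('a) - 1) ^ k" .
  qed
  finally show ?thesis
    by (simp add: Delannoy_poly_def poly_sum poly_monom)
qed

section \<open>Irreducible characters\<close>

lemma subspace_module_vec_iff:
  "VectorSpace.subspace class_ring W (module_vec TYPE('a::field) d) \<longleftrightarrow>
     W \<subseteq> carrier_vec d \<and> 0\<^sub>v d \<in> W \<and> (\<forall>v\<in>W. \<forall>w\<in>W. v + w \<in> W) \<and> (\<forall>c. \<forall>v\<in>W. c \<cdot>\<^sub>v v \<in> W)"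
proof -
  interpret vec_space "TYPE('a)" d .
  show ?thesis
    using vectorspace_axioms module_axioms
    by (auto simp: VectorSpace.subspace_def submodule_def module_vec_simps class_ring_simps)
qed

lemma GL_simps:
  "A \<in> carrier (GL d) \<longleftrightarrow> (\<exists>B\<in>carrier_mat d d. A \<in> carrier_mat d d \<and> A * B = 1\<^sub>m d \<and> B * A = 1\<^sub>m d)"
  "monoid.mult (GL d) = (*)" "monoid.one (GL d) = 1\<^sub>m d"
  by (auto simp: GL_def units_of_def Units_def ring_mat_simps)

lemma group_GL: "group (GL d)"
proof -
  interpret ring "ring_mat TYPE(complex) d ()" by (rule ring_mat)
  show ?thesis unfolding GL_def by (rule units_group)
qed

text \<open>Invertibility comes for free: the image of the inverse of \<open>g\<close> is a
  two-sided inverse of \<open>\<rho> g\<close>.\<close>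

lemma representationI:
  assumes "group G"
    and "\<And>g. g \<in> carrier G \<Longrightarrow> \<rho> g \<in> carrier_mat d d"
    and "\<And>g h. g \<in> carrier G \<Longrightarrow> h \<in> carrier G \<Longrightarrow> \<rho> (g \<otimes>\<^bsub>G\<^esub> h) = \<rho> g * \<rho> h"
    and "\<rho> \<one>\<^bsub>G\<^esub> = 1\<^sub>m d"
  shows "\<rho> \<in> hom G (GL d)"
proof -
  interpret group G by fact
  have "\<rho> g * \<rho> (inv\<^bsub>G\<^esub> g) = 1\<^sub>m d" "\<rho> (inv\<^bsub>G\<^esub> g) * \<rho> g = 1\<^sub>m d" if "g \<in> carrier G" for g
    using that assms(3)[of g "inv\<^bsub>G\<^esub> g"] assms(3)[of "inv\<^bsub>G\<^esub> g" g] assms(4) by simp_all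
  then have "\<rho> g \<in> carrier (GL d)" if "g \<in> carrier G" for g
    using that assms(2) unfolding GL_simps(1)
    by (intro bexI[of _ "\<rho> (inv\<^bsub>G\<^esub> g)"]) auto
  then show ?thesis
    using assms(3) by (auto intro!: homI simp: GL_simps(2))
qed

lemma representationD:
  assumes "group G" "\<rho> \<in> hom G (GL d)"
  shows "\<And>g. g \<in> carrier G \<Longrightarrow> \<rho> g \<in> carrier_mat d d"
    and "\<And>g h. g \<in> carrier G \<Longrightarrow> h \<in> carrier G \<Longrightarrow> \<rho> (g \<otimes>\<^bsub>G\<^esub> h) = \<rho> g * \<rho> h"
    and "\<rho> \<one>\<^bsub>G\<^esub> = 1\<^sub>m d"
  using hom_in_carrier[OF assms(2)] hom_mult[OF assms(2)] hom_one[OF assms(2) assms(1) group_GL]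
  by (auto simp: GL_simps)

text \<open>Over the complex numbers \<open>T\<close> has an eigenvalue. The eigenspace is invariant
  because \<open>T\<close> commutes with the representation, and it is nonzero, so irreducibility
  makes it the whole space.\<close>

lemma Schur_lemma:
  assumes "group G" "irreducible_representation G d \<rho>"
    and T: "T \<in> carrier_mat d d"
    and comm: "\<And>g. g \<in> carrier G \<Longrightarrow> \<rho> g * T = T * \<rho> g"
  obtains c where "T = c \<cdot>\<^sub>m 1\<^sub>m d"
proof -
  have \<rho>: "\<rho> \<in> hom G (GL d)" and d: "d > 0"
    and irr: "\<And>W. VectorSpace.subspace class_ring W (module_vec TYPE(complex) d) \<Longrightarrow>
          (\<And>g w. g \<in> carrier G \<Longrightarrow> w \<in> W \<Longrightarrow> \<rho> g *\<^sub>v w \<in> W) \<Longrightarrow>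
          W = {0\<^sub>v d} \<or> W = carrier_vec d"
    using assms(2) by (auto simp: irreducible_representation_def)
  note rep = representationD[OF assms(1) \<rho>]
  obtain c where "eigenvalue T c"
    using spectrum_non_empty[OF T d] by (auto simp: spectrum_def)
  then obtain v where v: "v \<in> carrier_vec d" "v \<noteq> 0\<^sub>v d" "T *\<^sub>v v = c \<cdot>\<^sub>v v"
    using T by (auto simp: eigenvalue_def eigenvector_def)
  define W where "W = {w \<in> carrier_vec d. T *\<^sub>v w = c \<cdot>\<^sub>v w}"
  have "W = {0\<^sub>v d} \<or> W = carrier_vec d"
  proof (rule irr)
    show "VectorSpace.subspace class_ring W (module_vec TYPE(complex) d)"
      using T unfolding subspace_module_vec_iff
      by (auto simp: W_def mult_add_distrib_mat_vec smult_add_distrib_vec mult_mat_vec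
          smult_smult_assoc mult.commute)
  next
    fix g w assume g: "g \<in> carrier G" and w: "w \<in> W"
    have "T *\<^sub>v (\<rho> g *\<^sub>v w) = (\<rho> g * T) *\<^sub>v w"
      using rep(1)[OF g] T w by (simp add: comm[OF g] W_def assoc_mult_mat_vec[of _ d d _ d])
    also have "\<dots> = c \<cdot>\<^sub>v (\<rho> g *\<^sub>v w)"
      using rep(1)[OF g] T w by (simp add: W_def assoc_mult_mat_vec[of _ d d _ d] mult_mat_vec)
    finally show "\<rho> g *\<^sub>v w \<in> W"
      using rep(1)[OF g] w by (auto simp: W_def)
  qed
  then have W: "W = carrier_vec d"
    using v by (auto simp: W_def)
  have "T = c \<cdot>\<^sub>m 1\<^sub>m d"
  proof (rule eq_matI)
    fix i j assume ij: "i < dim_row (c \<cdot>\<^sub>m 1\<^sub>m d)" "j < dim_col (c \<cdot>\<^sub>m 1\<^sub>m d)"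
    have "unit_vec d j \<in> W" by (simp add: W)
    then have "T *\<^sub>v unit_vec d j = c \<cdot>\<^sub>v unit_vec d j" by (simp add: W_def)
    then have "(T *\<^sub>v unit_vec d j) $ i = (c \<cdot>\<^sub>v unit_vec d j) $ i" by simp
    then show "T $$ (i, j) = (c \<cdot>\<^sub>m 1\<^sub>m d) $$ (i, j)"
      using ij T by (auto split: if_splits)
  qed (use T in auto)
  then show ?thesis by (rule that)
qed

section \<open>Orthogonality relations\<close>

lemma mult_mat_index:
  assumes "A \<in> carrier_mat n m" "B \<in> carrier_mat m p" "i < n" "j < p"
  shows "(A * B) $$ (i, j) = (\<Sum>k<m. A $$ (i, k) * B $$ (k, j))"
  using assms by (auto simp: scalar_prod_def atLeast0LessThan)

text \<open>For fixed \<open>j\<close> and \<open>k\<close> these sums are the entries of the sum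
  over g of \<rho>(g) E_jk \<rho>(g)^-1, where E_jk is a matrix unit. This matrix commutes with the
  representation, so it is scalar.\<close>

lemma Schur_orthogonality:
  assumes "group G" "finite (carrier G)" "irreducible_representation G d \<rho>"
    and "j < d" "k < d" "i < d" "l < d"
  shows "(\<Sum>g\<in>carrier G. \<rho> g $$ (i, j) * \<rho> (inv\<^bsub>G\<^esub> g) $$ (k, l)) =
    (if i = l \<and> j = k then of_nat (card (carrier G)) / of_nat d else 0)"
proof -
  interpret group G by fact
  have "\<rho> \<in> hom G (GL d)" and d: "d > 0"
    using assms(3) by (auto simp: irreducible_representation_def)
  note rep = representationD[OF assms(1) this(1)]
  define f where "f i l = (\<Sum>g\<in>carrier G. \<rho> g $$ (i, j) * \<rho> (inv\<^bsub>G\<^esub> g) $$ (k, l))" for i l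
  define T where "T = mat d d (\<lambda>(i, l). f i l)"
  have T: "T \<in> carrier_mat d d" by (simp add: T_def)
  have "\<rho> h * T = T * \<rho> h" if h: "h \<in> carrier G" for h
  proof (rule eq_matI)
    fix i l assume "i < dim_row (T * \<rho> h)" "l < dim_col (T * \<rho> h)"
    then have il: "i < d" "l < d" using rep(1)[OF h] by (auto simp: T_def)
    have "(\<rho> h * T) $$ (i, l) = (\<Sum>m<d. \<rho> h $$ (i, m) * f m l)"
      using il by (subst mult_mat_index[OF rep(1)[OF h] T]) (auto simp: T_def)
    also have "\<dots> = (\<Sum>g\<in>carrier G. (\<Sum>m<d. \<rho> h $$ (i, m) * \<rho> g $$ (m, j)) * \<rho> (inv\<^bsub>G\<^esub> g) $$ (k, l))"
      unfolding f_def sum_distrib_left sum_distrib_right mult.assoc by (rule sum.swap)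
    also have "\<dots> = (\<Sum>g\<in>carrier G. \<rho> (h \<otimes>\<^bsub>G\<^esub> g) $$ (i, j) * \<rho> (inv\<^bsub>G\<^esub> g) $$ (k, l))"
      using il assms(4-) h
      by (intro sum.cong refl) (simp add: rep(2) mult_mat_index[OF rep(1) rep(1)] del: index_mult_mat)
    \<comment> \<open>Replacing g by h^-1 g in the summation moves \<open>h\<close> from the first
      factor to the second.\<close>
    also have "\<dots> = (\<Sum>g\<in>carrier G. \<rho> g $$ (i, j) * \<rho> (inv\<^bsub>G\<^esub> g \<otimes>\<^bsub>G\<^esub> h) $$ (k, l))"
      using h by (intro sum.reindex_bij_witness[of _ "\<lambda>g. inv\<^bsub>G\<^esub> h \<otimes>\<^bsub>G\<^esub> g" "\<lambda>g. h \<otimes>\<^bsub>G\<^esub> g"])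
        (simp_all add: inv_mult_group m_assoc flip: m_assoc[of "inv\<^bsub>G\<^esub> h" h] m_assoc[of h "inv\<^bsub>G\<^esub> h"])
    also have "\<dots> = (\<Sum>g\<in>carrier G. \<rho> g $$ (i, j) * (\<Sum>m<d. \<rho> (inv\<^bsub>G\<^esub> g) $$ (k, m) * \<rho> h $$ (m, l)))"
      using il assms(4-) h
      by (intro sum.cong refl) (simp add: rep(2) mult_mat_index[OF rep(1) rep(1)] del: index_mult_mat)
    also have "\<dots> = (\<Sum>m<d. f i m * \<rho> h $$ (m, l))"
      unfolding f_def sum_distrib_left sum_distrib_right mult.assoc by (rule sum.swap)
    also have "\<dots> = (T * \<rho> h) $$ (i, l)"
      using il by (subst mult_mat_index[OF T rep(1)[OF h]]) (auto simp: T_def)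
    finally show "(\<rho> h * T) $$ (i, l) = (T * \<rho> h) $$ (i, l)" .
  qed (use rep(1)[OF h] in \<open>auto simp: T_def\<close>)
  then obtain c where c: "T = c \<cdot>\<^sub>m 1\<^sub>m d"
    using Schur_lemma[OF assms(1,3) T] by blast
  have f: "f i l = (if i = l then c else 0)" if "i < d" "l < d" for i l
    using that arg_cong[OF c, of "\<lambda>A. A $$ (i, l)"] by (simp add: T_def)
  \<comment> \<open>The scalar is found from the trace: reordering the factors turns the summand
    into the entry (k, j) of \<rho>(g)^-1 \<rho>(g), the identity.\<close>
  have "of_nat d * c = (\<Sum>i<d. f i i)"
    by (simp add: f)
  also have "\<dots> = (\<Sum>g\<in>carrier G. \<Sum>i<d. \<rho> (inv\<^bsub>G\<^esub> g) $$ (k, i) * \<rho> g $$ (i, j))"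
    unfolding f_def by (subst sum.swap) (simp add: mult.commute)
  also have "\<dots> = (\<Sum>g\<in>carrier G. (1\<^sub>m d :: complex mat) $$ (k, j))"
    using assms(4,5)
    by (intro sum.cong refl)
      (simp add: rep(3) flip: mult_mat_index[OF rep(1) rep(1)] rep(2) del: index_mult_mat index_one_mat)
  also have "\<dots> = (if j = k then of_nat (card (carrier G)) else 0)"
    using assms(4,5) by simp
  finally have "c = (if j = k then of_nat (card (carrier G)) / of_nat d else 0)"
    using d by (auto simp: field_simps)
  then show ?thesis
    using f[OF assms(6,7)] by (simp add: f_def)
qed

text \<open>Among the products of diagonal entries, orthogonality leaves d terms of value |G| / d.
  Evaluating at the inverse in place of complex conjugation avoids any appeal to unitary
  representations.\<close>

lemma irreducible_character_norm:
  assumes "group G" "finite (carrier G)" "\<chi> \<in> irreducible_characters G"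
  shows "(\<Sum>g\<in>carrier G. \<chi> g * \<chi> (inv\<^bsub>G\<^esub> g)) = of_nat (card (carrier G))"
proof -
  interpret group G by fact
  obtain d \<rho> where irr: "irreducible_representation G d \<rho>"
    and \<chi>: "\<chi> = restrict (\<lambda>g. mat_trace (\<rho> g)) (carrier G)"
    using assms(3) by (auto simp: irreducible_characters_def)
  have "\<rho> \<in> hom G (GL d)" and d: "d > 0"
    using irr by (auto simp: irreducible_representation_def)
  note rep = representationD[OF assms(1) this(1)]
  have tr: "\<chi> g = (\<Sum>i<d. \<rho> g $$ (i, i))" if "g \<in> carrier G" for g
    using that rep(1)[OF that] by (simp add: \<chi> mat_trace_def)
  have "(\<Sum>g\<in>carrier G. \<chi> g * \<chi> (inv\<^bsub>G\<^esub> g)) =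
      (\<Sum>g\<in>carrier G. \<Sum>i<d. \<Sum>l<d. \<rho> g $$ (i, i) * \<rho> (inv\<^bsub>G\<^esub> g) $$ (l, l))"
    by (simp add: tr sum_product)
  also have "\<dots> = (\<Sum>i<d. \<Sum>l<d. \<Sum>g\<in>carrier G. \<rho> g $$ (i, i) * \<rho> (inv\<^bsub>G\<^esub> g) $$ (l, l))"
    by (subst sum.swap) (intro sum.cong refl sum.swap)
  also have "\<dots> = (\<Sum>i<d. \<Sum>l<d. if i = l then of_nat (card (carrier G)) / of_nat d else 0)"
    using assms(2) by (intro sum.cong refl) (simp add: Schur_orthogonality[OF assms(1,2) irr])
  also have "\<dots> = of_nat (card (carrier G))"
    using d by simp
  finally show ?thesis .
qed

text \<open>
  A subspace stable under enough diagonal operators contains a vector of support one: subtracting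
  suitable multiples shrinks the support of a nonzero vector.
\<close>

lemma full_subspace_if_separated:
  fixes W :: "'a::field vec set"
  assumes "W \<subseteq> carrier_vec d" "0\<^sub>v d \<in> W"
    and add: "\<And>v w. v \<in> W \<Longrightarrow> w \<in> W \<Longrightarrow> v + w \<in> W"
    and smult: "\<And>c v. v \<in> W \<Longrightarrow> c \<cdot>\<^sub>v v \<in> W"
    and "W \<noteq> {0\<^sub>v d}"
    and sep: "\<And>i j. i < d \<Longrightarrow> j < d \<Longrightarrow> i \<noteq> j \<Longrightarrow>
      \<exists>c. c i \<noteq> c j \<and> (\<forall>w\<in>W. vec d (\<lambda>k. c k * w $ k) \<in> W)"
    and trans: "\<And>i j. i < d \<Longrightarrow> j < d \<Longrightarrow> unit_vec d i \<in> W \<Longrightarrow> \<exists>c. c \<noteq> 0 \<and> c \<cdot>\<^sub>v unit_vec d j \<in> W"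
  shows "W = carrier_vec d"
proof -
  define s where "s w = {k. k < d \<and> w $ k \<noteq> 0}" for w :: "'a vec"
  have fin: "finite (s w)" for w by (simp add: s_def)
  obtain w0 where w0: "w0 \<in> W" "w0 \<noteq> 0\<^sub>v d" using assms(2,5) by blast
  \<comment> \<open>A nonzero vector of \<open>W\<close> with as few nonzero coordinates as
    possible; it turns out to be a multiple of a unit vector.\<close>
  have "\<exists>w. (w \<in> W \<and> w \<noteq> 0\<^sub>v d) \<and> (\<forall>u. u \<in> W \<and> u \<noteq> 0\<^sub>v d \<longrightarrow> card (s w) \<le> card (s u))"
    using w0 by (intro ex_has_least_nat) auto
  then obtain w where w: "w \<in> W" "w \<noteq> 0\<^sub>v d"
    and min: "\<And>u. u \<in> W \<Longrightarrow> u \<noteq> 0\<^sub>v d \<Longrightarrow> card (s w) \<le> card (s u)"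
    by blast
  have wd: "w \<in> carrier_vec d" using w assms(1) by blast
  then obtain i where i: "i < d" "w $ i \<noteq> 0" using w(2) by (metis carrier_vecD eq_vecI index_zero_vec)
  have single: "w $ j = 0" if j: "j < d" "j \<noteq> i" for j
  proof (rule ccontr)
    assume wj: "w $ j \<noteq> 0"
    obtain c where c: "c i \<noteq> c j" "vec d (\<lambda>k. c k * w $ k) \<in> W"
      using sep[OF i(1) j(1)] j(2) w(1) by metis
    \<comment> \<open>Coordinate \<open>i\<close> is cancelled, coordinate \<open>j\<close> survives
      because \<open>c i\<close> and \<open>c j\<close> differ, and no zero coordinate of
      \<open>w\<close> becomes nonzero.\<close>
    define u where "u = vec d (\<lambda>k. c k * w $ k) + (- c i) \<cdot>\<^sub>v w"
    have uW: "u \<in> W" unfolding u_def using c w by (intro add smult)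
    have u: "u $ k = (c k - c i) * w $ k" if "k < d" for k
      using that wd by (simp add: u_def algebra_simps)
    have "u $ j \<noteq> 0" using u[OF j(1)] wj c(1) by simp
    then have "u \<noteq> 0\<^sub>v d" using j(1) by (metis index_zero_vec(1))
    then have "card (s w) \<le> card (s u)" by (rule min[OF uW])
    moreover have "s u \<subset> s w"
    proof
      show "s u \<subseteq> s w" by (auto simp: s_def u)
      have "i \<in> s w" "i \<notin> s u" using i by (simp_all add: s_def u)
      then show "s u \<noteq> s w" by blast
    qed
    then have "card (s u) < card (s w)" by (rule psubset_card_mono[OF fin])
    ultimately show False by simp
  qed
  have "inverse (w $ i) \<cdot>\<^sub>v w = unit_vec d i"
    using single i wd by (intro eq_vecI) auto
  then have unit_i: "unit_vec d i \<in> W" using smult[OF w(1), of "inverse (w $ i)"] by simp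
  have unit: "unit_vec d j \<in> W" if j: "j < d" for j
  proof -
    obtain c where c: "c \<noteq> 0" "c \<cdot>\<^sub>v unit_vec d j \<in> W" using trans[OF i(1) j unit_i] by blast
    have "inverse c \<cdot>\<^sub>v (c \<cdot>\<^sub>v unit_vec d j) = unit_vec d j"
      using c(1) by (simp add: smult_smult_assoc)
    then show ?thesis using smult[OF c(2), of "inverse c"] by simp
  qed
  \<comment> \<open>An arbitrary vector is assembled from multiples of unit vectors, by induction on
    the number \<open>m\<close> of leading coordinates.\<close>
  have "vec d (\<lambda>k. if k < m then v $ k else 0) \<in> W" if "m \<le> d" for v :: "'a vec" and m
    using that
  proof (induction m)
    case 0
    have "vec d (\<lambda>k. if k < 0 then v $ k else 0) = 0\<^sub>v d" by auto
    then show ?case using assms(2) by simp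
  next
    case (Suc m)
    have "vec d (\<lambda>k. if k < Suc m then v $ k else 0) =
        vec d (\<lambda>k. if k < m then v $ k else 0) + v $ m \<cdot>\<^sub>v unit_vec d m"
      using Suc.prems by (intro eq_vecI) (auto simp: less_Suc_eq)
    then show ?case using Suc unit by (auto intro!: add smult)
  qed
  moreover have "vec d (\<lambda>k. if k < d then v $ k else 0) = v" if "v \<in> carrier_vec d" for v :: "'a vec"
    using that by (intro eq_vecI) auto
  ultimately have "v \<in> W" if "v \<in> carrier_vec d" for v
    using that by (metis order_refl)
  then show ?thesis using assms(1) by auto
qed

section \<open>Additive characters\<close>

text \<open>Transports finiteness and cardinality from the extensional function space.\<close>

lemma supp_funs_bij:
  "bij_betw (\<lambda>f. restrict f T) (supp_funs T :: (nat \<Rightarrow> 'a::zero) set) (T \<rightarrow>\<^sub>E UNIV)"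
  by (rule bij_betw_byWitness[where f' = "\<lambda>f i. if i \<in> T then f i else 0"])
    (auto simp: supp_funs_def fun_eq_iff PiE_def extensional_def)

lemma
  assumes "finite T"
  shows finite_supp_funs: "finite (supp_funs T :: (nat \<Rightarrow> 'a::{zero,finite}) set)"
    and card_supp_funs: "card (supp_funs T :: (nat \<Rightarrow> 'a) set) = CARD('a) ^ card T"
  using assms bij_betw_finite[OF supp_funs_bij[of T, where 'a='a]]
    bij_betw_same_card[OF supp_funs_bij[of T, where 'a='a]]
  by (simp_all add: finite_PiE card_PiE)

context
  fixes \<theta> :: "'a::{field,finite} \<Rightarrow> complex"
  assumes \<theta>: "nontrivial_additive_character \<theta>"
begin

lemma add_char_add: "\<theta> (x + y) = \<theta> x * \<theta> y"
  and add_char_nonzero [simp]: "\<theta> x \<noteq> 0"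
  using \<theta> by (auto simp: nontrivial_additive_character_def)

lemma add_char_zero [simp]: "\<theta> 0 = 1"
  using add_char_add[of 0 0] add_char_nonzero[of 0] by simp

lemma add_char_nontrivial_multiple:
  assumes "x \<noteq> 0"
  obtains t where "\<theta> (t * x) \<noteq> 1"
proof -
  obtain y where "\<theta> y \<noteq> 1" using \<theta> by (auto simp: nontrivial_additive_character_def)
  then show ?thesis using assms that[of "y / x"] by simp
qed

lemma add_char_eq_iff: "\<theta> x = \<theta> y \<longleftrightarrow> \<theta> (x - y) = 1"
  using add_char_add[of "x - y" y] by simp

text \<open>\<theta> itself may fail to be injective, but for a nonzero difference x - y some
  multiple has a value other than 1. This is how coefficients are recovered from character
  values.\<close>

lemma add_char_separates:
  assumes "\<And>t. \<theta> (t * x) = \<theta> (t * y)"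
  shows "x = y"
proof (rule ccontr)
  assume "x \<noteq> y"
  then obtain t where "\<theta> (t * (x - y)) \<noteq> 1"
    using add_char_nontrivial_multiple[of "x - y"] by auto
  then show False
    using assms[of t] by (simp add: add_char_eq_iff[of "t * x"] algebra_simps)
qed

text \<open>Orthogonality of characters on F_q^T: if \<open>x k\<close> is nonzero, translating the
  summation variable by a suitable multiple of the k-th unit vector multiplies the sum by a factor
  other than 1.\<close>

lemma sum_add_char_supp_funs:
  assumes "finite T"
  shows "(\<Sum>d\<in>supp_funs T. \<theta> (\<Sum>i\<in>T. d i * x i)) =
    (if \<forall>i\<in>T. x i = 0 then of_nat (CARD('a) ^ card T) else 0)"
proof (cases "\<forall>i\<in>T. x i = 0")
  case True
  then show ?thesis using assms by (simp add: card_supp_funs)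
next
  case False
  then obtain k where k: "k \<in> T" "x k \<noteq> 0" by blast
  obtain t where t: "\<theta> (t * x k) \<noteq> 1" using add_char_nontrivial_multiple[OF k(2)] .
  define e where "e i = (if i = k then t else 0)" for i
  have e: "e \<in> supp_funs T" using k by (auto simp: e_def supp_funs_def)
  have e_sum: "(\<Sum>i\<in>T. e i * x i) = t * x k"
    using k assms by (simp add: e_def if_distrib[of "\<lambda>c. c * _"] cong: if_cong)
  have "(\<Sum>d\<in>supp_funs T. \<theta> (\<Sum>i\<in>T. d i * x i)) =
      (\<Sum>d\<in>supp_funs T. \<theta> (\<Sum>i\<in>T. (d i + e i) * x i))"
    using e by (intro sum.reindex_bij_witness[of _ "\<lambda>d i. d i + e i" "\<lambda>d i. d i - e i"])
      (auto simp: supp_funs_def)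
  also have "\<dots> = (\<Sum>d\<in>supp_funs T. \<theta> (\<Sum>i\<in>T. d i * x i)) * \<theta> (t * x k)"
    by (simp add: distrib_right sum.distrib add_char_add e_sum sum_distrib_right)
  finally show ?thesis using False t by auto
qed

lemma sum_add_char_UNIV: "(\<Sum>t\<in>UNIV. \<theta> (t * x)) = (if x = 0 then of_nat (CARD('a)) else 0)"
proof (cases "x = 0")
  case False
  obtain c where c: "\<theta> (c * x) \<noteq> 1" using add_char_nontrivial_multiple[OF False] .
  have "(\<Sum>t\<in>UNIV. \<theta> (t * x)) = (\<Sum>t\<in>UNIV. \<theta> ((t + c) * x))"
    by (rule sum.reindex_bij_witness[of _ "\<lambda>t. t + c" "\<lambda>t. t - c"]) auto
  also have "\<dots> = (\<Sum>t\<in>UNIV. \<theta> (t * x)) * \<theta> (c * x)"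
    by (simp add: distrib_right add_char_add sum_distrib_right)
  finally show ?thesis using False c by auto
qed simp

end

section \<open>The unitriangular group and its dual space\<close>

lemma unitri_simps [simp]: "monoid.mult (unitri n) = (*)" "monoid.one (unitri n) = 1\<^sub>m n"
  by (simp_all add: unitri_def)

lemma mem_unitri_iff:
  "g \<in> carrier (unitri n) \<longleftrightarrow>
     g \<in> carrier_mat n n \<and> upper_triangular g \<and> (\<forall>i<n. g $$ (i, i) = 1)"
proof
  assume "g \<in> carrier (unitri n)"
  then show "g \<in> carrier_mat n n \<and> upper_triangular g \<and> (\<forall>i<n. g $$ (i, i) = 1)"
    by (auto simp: unitri_def strictly_upper_def upper_triangular_def)
next
  assume g: "g \<in> carrier_mat n n \<and> upper_triangular g \<and> (\<forall>i<n. g $$ (i, i) = 1)"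
  then have "g - 1\<^sub>m n \<in> strictly_upper n" "g = 1\<^sub>m n + (g - 1\<^sub>m n)"
    by (auto simp: strictly_upper_def upper_triangular_def le_less)
  then show "g \<in> carrier (unitri n)" by (auto simp: unitri_def)
qed

lemma unitriD:
  assumes "g \<in> carrier (unitri n)"
  shows "g \<in> carrier_mat n n" "upper_triangular g" "\<And>i. i < n \<Longrightarrow> g $$ (i, i) = 1"
    "g - 1\<^sub>m n \<in> strictly_upper n" "dim_row g = n" "dim_col g = n"
  using assms by (auto simp: mem_unitri_iff strictly_upper_def upper_triangular_def le_less)

lemma strictly_upperD:
  assumes "X \<in> strictly_upper n"
  shows "X \<in> carrier_mat n n" "upper_triangular X" "\<And>i. i < n \<Longrightarrow> X $$ (i, i) = 0"
    "dim_row X = n" "dim_col X = n"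
  using assms by (auto simp: strictly_upper_def upper_triangular_def)

lemma strictly_upperI:
  assumes "X \<in> carrier_mat n n" "upper_triangular X" "\<And>i. i < n \<Longrightarrow> X $$ (i, i) = 0"
  shows "X \<in> strictly_upper n"
  using assms by (auto simp: strictly_upper_def upper_triangular_def le_less)

text \<open>Only indices between \<open>i\<close> and \<open>j\<close> contribute. On the first two
  superdiagonals this leaves two or three terms, from which the entry formulas below are
  obtained.\<close>

lemma upper_triangular_mult_index:
  fixes A B :: "'a::semiring_0 mat"
  assumes "A \<in> carrier_mat n n" "B \<in> carrier_mat n n" "upper_triangular A" "upper_triangular B"
    and "i < n" "j < n"
  shows "(A * B) $$ (i, j) = (\<Sum>k = i..j. A $$ (i, k) * B $$ (k, j))"
proof -
  have "(A * B) $$ (i, j) = (\<Sum>k = 0..<n. A $$ (i, k) * B $$ (k, j))"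
    using assms by (auto simp: scalar_prod_def)
  also have "\<dots> = (\<Sum>k = i..j. A $$ (i, k) * B $$ (k, j))"
    using assms by (intro sum.mono_neutral_right) (auto simp: upper_triangular_def not_le)
  finally show ?thesis .
qed

lemma upper_triangular_mult:
  fixes A B :: "'a::semiring_0 mat"
  assumes "A \<in> carrier_mat n n" "B \<in> carrier_mat n n" "upper_triangular A" "upper_triangular B"
  shows "upper_triangular (A * B)"
  using assms upper_triangular_mult_index[OF assms]
  by (auto simp: upper_triangular_def simp del: index_mult_mat(1))

lemma unitri_mult_closed:
  assumes "g \<in> carrier (unitri n)" "h \<in> carrier (unitri n)"
  shows "g * h \<in> carrier (unitri n)"
  using unitriD[OF assms(1)] unitriD[OF assms(2)]
  by (simp add: mem_unitri_iff upper_triangular_mult[of _ n] upper_triangular_mult_index[of _ n]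
      del: index_mult_mat(1))

lemma strictly_upper_mult:
  assumes "g \<in> carrier (unitri n)" "X \<in> strictly_upper n"
  shows "g * X \<in> strictly_upper n" "X * g \<in> strictly_upper n"
  using unitriD[OF assms(1)] strictly_upperD[OF assms(2)]
  by (auto intro!: strictly_upperI simp: upper_triangular_mult[of _ n] upper_triangular_mult_index[of _ n]
      simp del: index_mult_mat(1))

lemma finite_carrier_mat: "finite (carrier_mat n m :: 'a::finite mat set)"
proof (rule finite_subset)
  show "carrier_mat n m \<subseteq> mat n m ` (({..<n} \<times> {..<m}) \<rightarrow>\<^sub>E (UNIV :: 'a set))"
  proof
    fix A :: "'a mat" assume "A \<in> carrier_mat n m"
    then show "A \<in> mat n m ` (({..<n} \<times> {..<m}) \<rightarrow>\<^sub>E UNIV)"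
      by (intro image_eqI[where x = "restrict (\<lambda>p. A $$ p) ({..<n} \<times> {..<m})"]) auto
  qed
qed (intro finite_imageI finite_PiE, auto)

lemma finite_unitri: "finite (carrier (unitri n :: 'a::{field,finite} mat monoid))"
  by (rule finite_subset[OF _ finite_carrier_mat[of n n]]) (auto simp: mem_unitri_iff)

lemma det_unitri:
  assumes "g \<in> carrier (unitri n)"
  shows "det g = 1"
proof -
  have "diag_mat g = map (\<lambda>_. 1) [0..<n]"
    using unitriD[OF assms] by (auto simp: diag_mat_def)
  then show ?thesis
    using det_upper_triangular[OF unitriD(2,1)[OF assms]] by (simp add: map_replicate_const)
qed

text \<open>The left inverse is obtained by counting: right multiplication by \<open>g\<close> is
  injective because \<open>g\<close> is invertible as a matrix, so on the finite carrier it is onto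
  and reaches the identity.\<close>

lemma group_unitri: "group (unitri n :: 'a::{field,finite} mat monoid)"
proof (rule groupI)
  fix g :: "'a mat" assume g: "g \<in> carrier (unitri n)"
  note gD = unitriD[OF g]
  have "g \<in> Units (ring_mat TYPE('a) n ())"
    using det_non_zero_imp_unit[OF gD(1)] det_unitri[OF g] by simp
  then obtain B where B: "B \<in> carrier_mat n n" "g * B = 1\<^sub>m n"
    by (auto simp: Units_def ring_mat_simps)
  have "inj_on (\<lambda>h. h * g) (carrier (unitri n))"
  proof (rule inj_onI)
    fix h h' assume h: "h \<in> carrier (unitri n)" "h' \<in> carrier (unitri n)" "h * g = h' * g"
    then have "(h * g) * B = (h' * g) * B" by simp
    then show "h = h'"
      using unitriD(1)[OF h(1)] unitriD(1)[OF h(2)] gD(1) B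
      by (simp add: assoc_mult_mat[of _ n n _ n])
  qed
  moreover have "(\<lambda>h. h * g) ` carrier (unitri n) \<subseteq> carrier (unitri n)"
    using g by (auto intro: unitri_mult_closed)
  ultimately have "(\<lambda>h. h * g) ` carrier (unitri n) = carrier (unitri n)"
    by (intro endo_inj_surj finite_unitri)
  moreover have "1\<^sub>m n \<in> carrier (unitri n :: 'a mat monoid)"
    by (simp add: mem_unitri_iff)
  ultimately show "\<exists>h\<in>carrier (unitri n). h \<otimes>\<^bsub>unitri n\<^esub> g = \<one>\<^bsub>unitri n\<^esub>"
    by (metis (no_types, lifting) imageE unitri_simps)
next
  fix x y z :: "'a mat"
  assume "x \<in> carrier (unitri n)" "y \<in> carrier (unitri n)" "z \<in> carrier (unitri n)"
  then show "x \<otimes>\<^bsub>unitri n\<^esub> y \<otimes>\<^bsub>unitri n\<^esub> z = x \<otimes>\<^bsub>unitri n\<^esub> (y \<otimes>\<^bsub>unitri n\<^esub> z)"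
    using unitriD(1)[of x] unitriD(1)[of y] unitriD(1)[of z]
    by (simp add: assoc_mult_mat[of x n n y n z n])
qed (simp_all add: unitri_mult_closed mem_unitri_iff[of "1\<^sub>m n"] unitriD(1) left_mult_one_mat[of _ n n])

interpretation unitri: group "unitri n :: 'a::{field,finite} mat monoid" for n
  by (rule group_unitri)

text \<open>The first superdiagonal is additive. The mixed term on the second one produces both the
  commutators and the cocycle of the representation constructed below.\<close>

lemma unitri_mult_index:
  assumes "g \<in> carrier (unitri n)" "h \<in> carrier (unitri n)"
  shows "Suc i < n \<Longrightarrow> (g * h) $$ (i, Suc i) = g $$ (i, Suc i) + h $$ (i, Suc i)"
    and "Suc (Suc i) < n \<Longrightarrow> (g * h) $$ (i, Suc (Suc i)) =
      g $$ (i, Suc (Suc i)) + h $$ (i, Suc (Suc i)) +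
      g $$ (i, Suc i) * h $$ (Suc i, Suc (Suc i))"
  using unitriD[OF assms(1)] unitriD[OF assms(2)]
  by (simp_all add: upper_triangular_mult_index[of _ n] del: index_mult_mat(1))

lemma unitri_strictly_upper_mult_index:
  assumes "g \<in> carrier (unitri n)" "X \<in> strictly_upper n"
  shows "Suc i < n \<Longrightarrow> (g * X) $$ (i, Suc i) = X $$ (i, Suc i)"
    and "Suc (Suc i) < n \<Longrightarrow> (g * X) $$ (i, Suc (Suc i)) =
      X $$ (i, Suc (Suc i)) + g $$ (i, Suc i) * X $$ (Suc i, Suc (Suc i))"
    and "Suc i < n \<Longrightarrow> (X * g) $$ (i, Suc i) = X $$ (i, Suc i)"
    and "Suc (Suc i) < n \<Longrightarrow> (X * g) $$ (i, Suc (Suc i)) =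
      X $$ (i, Suc (Suc i)) + X $$ (i, Suc i) * g $$ (Suc i, Suc (Suc i))"
  using unitriD[OF assms(1)] strictly_upperD[OF assms(2)]
  by (simp_all add: upper_triangular_mult_index[of _ n] add.commute del: index_mult_mat(1))

lemma unitri_inv_index:
  fixes g :: "'a::{field,finite} mat"
  assumes g: "g \<in> carrier (unitri n)"
  shows "Suc i < n \<Longrightarrow> (inv\<^bsub>unitri n\<^esub> g) $$ (i, Suc i) = - g $$ (i, Suc i)"
    and "Suc (Suc i) < n \<Longrightarrow> (inv\<^bsub>unitri n\<^esub> g) $$ (i, Suc (Suc i)) =
      g $$ (i, Suc i) * g $$ (Suc i, Suc (Suc i)) - g $$ (i, Suc (Suc i))"
proof -
  have eq: "g * (inv\<^bsub>unitri n\<^esub> g) = 1\<^sub>m n" using unitri.r_inv[OF g] by simp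
  note idx = unitri_mult_index[OF g unitri.inv_closed[OF g], unfolded eq]
  show 1: "(inv\<^bsub>unitri n\<^esub> g) $$ (i, Suc i) = - g $$ (i, Suc i)" if "Suc i < n" for i
    using idx(1)[OF that] that by (simp add: eq_neg_iff_add_eq_0 add.commute)
  show "(inv\<^bsub>unitri n\<^esub> g) $$ (i, Suc (Suc i)) =
      g $$ (i, Suc i) * g $$ (Suc i, Suc (Suc i)) - g $$ (i, Suc (Suc i))" if "Suc (Suc i) < n"
    using idx(2)[OF that] that by (simp add: 1 algebra_simps eq_neg_iff_add_eq_0)
qed

text \<open>A group element with prescribed first superdiagonal. It serves as a witness in the orbit
  computations, as a coset representative and as an operator in the irreducibility proof.\<close>

definition superdiagonal :: "nat \<Rightarrow> (nat \<Rightarrow> 'a::field) \<Rightarrow> 'a mat" where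
  "superdiagonal n c = mat n n (\<lambda>(i, j). if i = j then 1 else if j = Suc i then c i else 0)"

definition elementary :: "nat \<Rightarrow> nat \<Rightarrow> nat \<Rightarrow> 'a::zero \<Rightarrow> 'a mat" where
  "elementary n i j t = mat n n (\<lambda>p. if p = (i, j) then t else 0)"

definition transvection :: "nat \<Rightarrow> nat \<Rightarrow> nat \<Rightarrow> 'a::field \<Rightarrow> 'a mat" where
  "transvection n i j t = 1\<^sub>m n + elementary n i j t"

lemma superdiagonal_closed [simp]: "superdiagonal n c \<in> carrier (unitri n)"
  by (auto simp: superdiagonal_def mem_unitri_iff upper_triangular_def)

lemma superdiagonal_index [simp]:
  "Suc i < n \<Longrightarrow> superdiagonal n c $$ (i, Suc i) = c i"
  "Suc (Suc i) < n \<Longrightarrow> superdiagonal n c $$ (i, Suc (Suc i)) = 0"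
  by (simp_all add: superdiagonal_def)

lemma elementary_closed [simp]: "i < j \<Longrightarrow> elementary n i j t \<in> strictly_upper n"
  by (auto simp: elementary_def strictly_upper_def)

lemma transvection_closed [simp]: "i < j \<Longrightarrow> transvection n i j t \<in> carrier (unitri n)"
  unfolding transvection_def unitri_def by (auto intro!: exI[of _ "elementary n i j t"])

lemma transvection_minus_one [simp]: "transvection n i j t - 1\<^sub>m n = elementary n i j t"
  by (rule eq_matI) (auto simp: transvection_def elementary_def)

lemma smult_elementary: "c \<cdot>\<^sub>m elementary n i j t = elementary n i j (c * t :: 'a::semiring_0)"
  by (rule eq_matI) (auto simp: elementary_def)

section \<open>Linear functionals and their coefficients\<close>

lemma dualD:
  assumes "l \<in> dual n"
  shows "l \<in> extensional (strictly_upper n)"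
    and "\<And>X Y. X \<in> strictly_upper n \<Longrightarrow> Y \<in> strictly_upper n \<Longrightarrow> l (X + Y) = l X + l Y"
    and "\<And>c X. X \<in> strictly_upper n \<Longrightarrow> l (c \<cdot>\<^sub>m X) = c * l X"
  using assms by (auto simp: dual_def)

lemma dual_elementary:
  assumes "l \<in> dual n" "i < j"
  shows "l (elementary n i j t) = t * l (elementary n i j 1)"
  using dualD(3)[OF assms(1) elementary_closed[OF assms(2)], of t 1] by (simp add: smult_elementary)

lemma dual_zero:
  assumes "l \<in> dual n"
  shows "l (0\<^sub>m n n) = 0"
proof -
  have "0\<^sub>m n n \<in> strictly_upper n" by (simp add: strictly_upper_def)
  from dualD(3)[OF assms this, of 0] show ?thesis by simp
qed

lemma dual_eqI:
  assumes l: "l \<in> dual n" and l': "l' \<in> dual n"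
    and eq: "\<And>i j. i < j \<Longrightarrow> j < n \<Longrightarrow> l (elementary n i j 1) = l' (elementary n i j 1)"
  shows "l = l'"
proof (rule extensionalityI[OF dualD(1)[OF l] dualD(1)[OF l']])
  fix X :: "'a mat" assume X: "X \<in> strictly_upper n"
  \<comment> \<open>Keeps only the entries of \<open>X\<close> at positions in \<open>I\<close>;
    adding positions one at a time reduces the claim to elementary matrices.\<close>
  define part where "part I = mat n n (\<lambda>p. if p \<in> I then X $$ p else 0)" for I
  have part: "part I \<in> strictly_upper n" for I
    using X by (auto simp: part_def strictly_upper_def)
  have "l (part I) = l' (part I)" if "finite I" "I \<subseteq> {(i, j). i < j \<and> j < n}" for I
    using that
  proof (induction I)
    case empty
    have "part {} = 0\<^sub>m n n" by (auto simp: part_def)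
    then show ?case using dual_zero[OF l] dual_zero[OF l'] by simp
  next
    case (insert p I)
    obtain i j where p: "p = (i, j)" "i < j" "j < n" using insert by auto
    have "part (insert p I) = part I + X $$ p \<cdot>\<^sub>m elementary n i j 1"
      using insert(2) p by (auto simp: part_def elementary_def intro!: eq_matI)
    moreover have "elementary n i j (X $$ p) \<in> strictly_upper n" using p by simp
    ultimately show ?case
      using insert eq[OF p(2,3)] dualD(2)[OF l part] dualD(2)[OF l' part]
      by (simp add: smult_elementary dual_elementary[OF l p(2), of "X $$ p"]
          dual_elementary[OF l' p(2), of "X $$ p"])
  qed
  moreover have "finite {(i, j). i < j \<and> j < n}"
    by (rule finite_subset[of _ "{..<n} \<times> {..<n}"]) auto
  moreover have "part {(i, j). i < j \<and> j < n} = X"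
    using X by (auto simp: part_def strictly_upper_def intro!: eq_matI)
  ultimately show "l X = l' X" by (metis (no_types, lifting) order_refl)
qed

lemma dual_act:
  assumes l: "l \<in> dual n" and "h \<in> carrier (unitri n)" "k \<in> carrier (unitri n)"
  shows "restrict (\<lambda>X. l (h * (X * k))) (strictly_upper n) \<in> dual n"
proof -
  note h = unitriD(1)[OF assms(2)] and k = unitriD(1)[OF assms(3)]
  have 1: "h * ((X + Y) * k) = h * (X * k) + h * (Y * k)"
    if "X \<in> strictly_upper n" "Y \<in> strictly_upper n" for X Y
    using strictly_upperD(1)[OF that(1)] strictly_upperD(1)[OF that(2)] h k
    by (simp add: add_mult_distrib_mat[of _ n n] mult_add_distrib_mat[of _ n n _ n])
  have 2: "h * ((c \<cdot>\<^sub>m X) * k) = c \<cdot>\<^sub>m (h * (X * k))" if "X \<in> strictly_upper n" for c X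
    using strictly_upperD(1)[OF that] h k
    by (simp add: mult_smult_assoc_mat[of _ n n] mult_smult_distrib[of _ n n _ n])
  have cl: "h * (X * k) \<in> strictly_upper n" if "X \<in> strictly_upper n" for X
    using strictly_upper_mult assms that by blast
  have "X + Y \<in> strictly_upper n" "c \<cdot>\<^sub>m X \<in> strictly_upper n"
    if "X \<in> strictly_upper n" "Y \<in> strictly_upper n" for X Y :: "'a mat" and c
    using that by (auto simp: strictly_upper_def)
  then show ?thesis
    unfolding dual_def by (auto simp: 1 2 cl dualD(2,3)[OF l])
qed

text \<open>Defined on all matrices so that it applies directly to group elements: it does not see
  the diagonal, hence subtracting the identity changes nothing.\<close>

definition band_sum :: "nat \<Rightarrow> (nat \<Rightarrow> 'a) \<Rightarrow> (nat \<Rightarrow> 'a) \<Rightarrow> 'a::field mat \<Rightarrow> 'a" where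
  "band_sum n a b X =
     (\<Sum>i<n - 1. a i * X $$ (i, Suc i)) + (\<Sum>i<n - 2. b i * X $$ (i, Suc (Suc i)))"

definition band_functional :: "nat \<Rightarrow> (nat \<Rightarrow> 'a) \<Rightarrow> (nat \<Rightarrow> 'a) \<Rightarrow> 'a::field mat \<Rightarrow> 'a" where
  "band_functional n a b = restrict (band_sum n a b) (strictly_upper n)"

lemma band_functional_dual: "band_functional n a b \<in> dual n"
proof -
  have "X + Y \<in> strictly_upper n" "c \<cdot>\<^sub>m X \<in> strictly_upper n"
    if "X \<in> strictly_upper n" "Y \<in> strictly_upper n" for X Y :: "'a mat" and c
    using that by (auto simp: strictly_upper_def)
  moreover have "band_sum n a b (X + Y) = band_sum n a b X + band_sum n a b Y"
    if "X \<in> strictly_upper n" "Y \<in> strictly_upper n" for X Y :: "'a mat"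
    using strictly_upperD(4,5)[OF that(1)] strictly_upperD(4,5)[OF that(2)]
    by (simp add: band_sum_def algebra_simps sum.distrib)
  moreover have "band_sum n a b (c \<cdot>\<^sub>m X) = c * band_sum n a b X"
    if "X \<in> strictly_upper n" for X :: "'a mat" and c
    using strictly_upperD(4,5)[OF that(1)]
    by (simp add: band_sum_def algebra_simps sum_distrib_left)
  ultimately show ?thesis by (auto simp: dual_def band_functional_def)
qed

lemma band_sum_elementary:
  assumes "i < j" "j < n"
  shows "band_sum n a b (elementary n i j t) =
    (if j = Suc i then a i * t else if j = Suc (Suc i) then b i * t else 0)"
proof -
  have 1: "(\<Sum>k<n - 1. a k * elementary n i j t $$ (k, Suc k)) =
      (\<Sum>k<n - 1. if k = i then (if j = Suc i then a i * t else 0) else 0)"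
    by (intro sum.cong) (auto simp: elementary_def)
  have 2: "(\<Sum>k<n - 2. b k * elementary n i j t $$ (k, Suc (Suc k))) =
      (\<Sum>k<n - 2. if k = i then (if j = Suc (Suc i) then b i * t else 0) else 0)"
    by (intro sum.cong) (auto simp: elementary_def)
  show ?thesis using assms unfolding band_sum_def 1 2 by auto
qed

lemma band_functional_eq_iff:
  "band_functional n a b = band_functional n a' b' \<longleftrightarrow>
     (\<forall>i<n - 1. a i = a' i) \<and> (\<forall>i<n - 2. b i = b' i)"
proof
  assume eq: "band_functional n a b = band_functional n a' b'"
  have "a i = a' i" if "i < n - 1" for i
    using that fun_cong[OF eq, of "elementary n i (Suc i) 1"]
    by (simp add: band_functional_def band_sum_elementary)
  moreover have "b i = b' i" if "i < n - 2" for i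
    using that fun_cong[OF eq, of "elementary n i (Suc (Suc i)) 1"]
    by (simp add: band_functional_def band_sum_elementary)
  ultimately show "(\<forall>i<n - 1. a i = a' i) \<and> (\<forall>i<n - 2. b i = b' i)" by blast
next
  assume "(\<forall>i<n - 1. a i = a' i) \<and> (\<forall>i<n - 2. b i = b' i)"
  then have "band_sum n a b = band_sum n a' b'" by (auto simp: band_sum_def fun_eq_iff)
  then show "band_functional n a b = band_functional n a' b'" by (simp add: band_functional_def)
qed

lemma band_functional_if_vanishing:
  assumes l: "l \<in> dual n"
    and "\<And>i j. i + 3 \<le> j \<Longrightarrow> j < n \<Longrightarrow> l (elementary n i j 1) = 0"
  shows "\<exists>a b. a \<in> supp_funs {..<n - 1} \<and> b \<in> supp_funs {..<n - 2} \<and> l = band_functional n a b"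
proof (intro exI conjI)
  define a where "a i = (if i < n - 1 then l (elementary n i (Suc i) 1) else 0)" for i
  define b where "b i = (if i < n - 2 then l (elementary n i (Suc (Suc i)) 1) else 0)" for i
  show "a \<in> supp_funs {..<n - 1}" "b \<in> supp_funs {..<n - 2}"
    by (auto simp: supp_funs_def a_def b_def)
  show "l = band_functional n a b"
  proof (rule dual_eqI[OF l band_functional_dual])
    fix i j assume "i < j" "j < n"
    moreover have "j = Suc i \<or> j = Suc (Suc i) \<or> i + 3 \<le> j" using \<open>i < j\<close> by auto
    ultimately show "l (elementary n i j 1) = band_functional n a b (elementary n i j 1)"
      using assms(2)[of i j] by (auto simp: band_functional_def band_sum_elementary a_def b_def)
  qed
qed

section \<open>Supercharacters supported on two superdiagonals\<close>

lemma one_unitri [simp]: "1\<^sub>m n \<in> carrier (unitri n :: 'a::{field,finite} mat monoid)"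
  using unitri.one_closed[of n] by simp

text \<open>Running over inverses of group elements removes the inverse from the action. The right
  factor \<open>1\<^sub>m n\<close> gives left orbits the same shape as two-sided ones, so one
  formula for the action covers both.\<close>

lemma left_orbit_eq:
  fixes l :: "'a::{field,finite} mat \<Rightarrow> 'a"
  shows "left_orbit n l =
    (\<lambda>h. restrict (\<lambda>X. l (h * (X * 1\<^sub>m n))) (strictly_upper n)) ` carrier (unitri n)"
proof -
  have act: "left_act n g l = restrict (\<lambda>X. l (inv\<^bsub>unitri n\<^esub> g * (X * 1\<^sub>m n))) (strictly_upper n)"
    for g
    unfolding left_act_def using strictly_upperD(1) by (intro restrict_ext) force
  have "\<exists>g'\<in>carrier (unitri n). inv\<^bsub>unitri n\<^esub> g' = g" if "g \<in> carrier (unitri n)" for g :: "'a mat"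
    using that by (intro bexI[of _ "inv\<^bsub>unitri n\<^esub> g"]) auto
  then show ?thesis
    unfolding left_orbit_def act image_def using unitri.inv_closed by blast
qed

lemma two_sided_orbit_eq:
  fixes l :: "'a::{field,finite} mat \<Rightarrow> 'a"
  shows "two_sided_orbit n l =
    (\<lambda>(h, k). restrict (\<lambda>X. l (h * (X * k))) (strictly_upper n)) `
      (carrier (unitri n) \<times> carrier (unitri n))" (is "_ = ?f ` _")
proof (intro equalityI subsetI)
  have act: "right_act n (left_act n g l) k = ?f (inv\<^bsub>unitri n\<^esub> g, inv\<^bsub>unitri n\<^esub> k)"
    if "g \<in> carrier (unitri n)" "k \<in> carrier (unitri n)" for g k
    unfolding right_act_def left_act_def prod.case
    using that by (intro restrict_ext) (simp add: strictly_upper_mult)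
  fix m
  show "m \<in> ?f ` (carrier (unitri n) \<times> carrier (unitri n))" if mem: "m \<in> two_sided_orbit n l"
  proof -
    from mem[unfolded two_sided_orbit_def] obtain g k
      where gk: "g \<in> carrier (unitri n)" "k \<in> carrier (unitri n)"
        and m: "m = right_act n (left_act n g l) k"
      by (elim CollectE exE conjE)
    show ?thesis
      unfolding m act[OF gk] by (intro imageI SigmaI unitri.inv_closed gk)
  qed
  show "m \<in> two_sided_orbit n l" if mem: "m \<in> ?f ` (carrier (unitri n) \<times> carrier (unitri n))"
  proof -
    from mem obtain h k
      where hk: "h \<in> carrier (unitri n)" "k \<in> carrier (unitri n)" and m: "m = ?f (h, k)"
      by (elim imageE SigmaE) simp
    note hk' = unitri.inv_closed[OF hk(1)] unitri.inv_closed[OF hk(2)]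
    have "m = right_act n (left_act n (inv\<^bsub>unitri n\<^esub> h) l) (inv\<^bsub>unitri n\<^esub> k)"
      unfolding m act[OF hk'] unitri.inv_inv[OF hk(1)] unitri.inv_inv[OF hk(2)] ..
    then show ?thesis
      unfolding two_sided_orbit_def
      by (intro CollectI exI[of _ "inv\<^bsub>unitri n\<^esub> h"] exI[of _ "inv\<^bsub>unitri n\<^esub> k"] conjI hk')
  qed
qed

section \<open>Orbits of band functionals\<close>

lemma supp_funs_nonzeroD: "f \<in> supp_funs T \<Longrightarrow> f i \<noteq> 0 \<Longrightarrow> i \<in> T"
  by (auto simp: supp_funs_def)

text \<open>The set S of the introductory text; \<open>i\<close> represents the arc from i to i +
  2.\<close>

definition arcs :: "(nat \<Rightarrow> 'a::zero) \<Rightarrow> nat set" where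
  "arcs b = {i. b i \<noteq> 0}"

text \<open>The set F of the introductory text: the indices i for which the two-sided action can
  change the coefficient at (i, i + 1).\<close>

definition arc_feet :: "(nat \<Rightarrow> 'a::zero) \<Rightarrow> nat set" where
  "arc_feet b = arcs b \<union> Suc ` arcs b"

lemma
  assumes "b \<in> supp_funs {..<n - 2}"
  shows arcs_subset: "arcs b \<subseteq> {..<n - 2}"
    and finite_arcs: "finite (arcs b)"
    and arc_feet_subset: "arc_feet b \<subseteq> {..<n - 1}"
    and finite_arc_feet: "finite (arc_feet b)"
proof -
  show 1: "arcs b \<subseteq> {..<n - 2}" using supp_funs_nonzeroD[OF assms] by (auto simp: arcs_def)
  then show "finite (arcs b)" by (rule finite_subset) simp
  then show "finite (arc_feet b)" by (simp add: arc_feet_def)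
  show "arc_feet b \<subseteq> {..<n - 1}" using 1 by (fastforce simp: arc_feet_def)
qed

text \<open>The change of the coefficients on the first superdiagonal caused by X -> h X k: the
  right factor acts at the arcs themselves, the left factor one index later.\<close>

definition act_shift :: "(nat \<Rightarrow> 'a) \<Rightarrow> 'a::field mat \<Rightarrow> 'a mat \<Rightarrow> nat \<Rightarrow> 'a" where
  "act_shift b h k j = b j * k $$ (Suc j, Suc (Suc j)) +
     (case j of 0 \<Rightarrow> 0 | Suc i \<Rightarrow> b i * h $$ (i, Suc i))"

text \<open>The entry of h X k at (i, i + 2) is that of X plus X_{i,i+1} k_{i+1,i+2} and h_{i,i+1}
  X_{i+1,i+2}. Collecting terms by the first superdiagonal of \<open>X\<close> yields the shift of
  \<open>a\<close>.\<close>

lemma band_functional_act: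
  assumes "h \<in> carrier (unitri n)" "k \<in> carrier (unitri n)" and b: "b \<in> supp_funs {..<n - 2}"
  shows "restrict (\<lambda>X. band_functional n a b (h * (X * k))) (strictly_upper n) =
    band_functional n (\<lambda>j. a j + act_shift b h k j) b"
proof -
  have "band_functional n a b (h * (X * k)) = band_sum n (\<lambda>j. a j + act_shift b h k j) b X"
    if X: "X \<in> strictly_upper n" for X
  proof (cases "n \<ge> 2")
    case True
    then obtain m where n: "n = Suc (Suc m)" by (metis add_2_eq_Suc le_Suc_ex)
    \<comment> \<open>The first index beyond the second superdiagonal; since \<open>b\<close>
      vanishes there, sums along that superdiagonal may be extended to the length of the first
      one.\<close>
    have bm: "b m = 0" using b by (simp add: supp_funs_def n)
    note Xk = strictly_upper_mult(2)[OF assms(2) X]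
    have "band_functional n a b (h * (X * k)) = band_sum n a b (h * (X * k))"
      using strictly_upper_mult(1)[OF assms(1) Xk] by (simp add: band_functional_def)
    also have "\<dots> = (\<Sum>i<Suc m. a i * X $$ (i, Suc i)) +
        (\<Sum>i<m. b i * (X $$ (i, Suc (Suc i)) + X $$ (i, Suc i) * k $$ (Suc i, Suc (Suc i)) +
           h $$ (i, Suc i) * X $$ (Suc i, Suc (Suc i))))"
      unfolding band_sum_def n diff_Suc_Suc numeral_2_eq_2 diff_Suc_1 diff_zero
      by (intro arg_cong2[of _ _ _ _ "(+)"] sum.cong refl)
        (simp_all add: unitri_strictly_upper_mult_index[OF assms(1) Xk]
          unitri_strictly_upper_mult_index[OF assms(2) X] n del: index_mult_mat(1))
    also have "\<dots> = band_sum n (\<lambda>j. a j + act_shift b h k j) b X"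
    proof -
      have "(\<Sum>j<Suc m. act_shift b h k j * X $$ (j, Suc j)) =
        (\<Sum>j<Suc m. b j * k $$ (Suc j, Suc (Suc j)) * X $$ (j, Suc j)) +
        (\<Sum>j<Suc m. (case j of 0 \<Rightarrow> 0 | Suc i \<Rightarrow> b i * h $$ (i, Suc i)) * X $$ (j, Suc j))"
        by (simp add: act_shift_def distrib_right sum.distrib del: sum.lessThan_Suc)
      \<comment> \<open>The left factor contributes only from index 1 on, so shifting the summation
        drops the zero term.\<close>
      also have "(\<Sum>j<Suc m. (case j of 0 \<Rightarrow> 0 | Suc i \<Rightarrow> b i * h $$ (i, Suc i)) * X $$ (j, Suc j)) =
        (\<Sum>i<m. b i * h $$ (i, Suc i) * X $$ (Suc i, Suc (Suc i)))"
        by (subst sum.lessThan_Suc_shift) simp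
      also have "(\<Sum>j<Suc m. b j * k $$ (Suc j, Suc (Suc j)) * X $$ (j, Suc j)) =
        (\<Sum>j<m. b j * k $$ (Suc j, Suc (Suc j)) * X $$ (j, Suc j))"
        by (simp add: bm)
      finally show ?thesis
        unfolding band_sum_def n
        by (simp add: distrib_left distrib_right sum.distrib mult.assoc mult.left_commute mult.commute
            del: sum.lessThan_Suc)
    qed
    finally show ?thesis .
  next
    case False
    then have "n - 1 = 0" "n - 2 = 0" by auto
    then show ?thesis
      using strictly_upper_mult(1)[OF assms(1) strictly_upper_mult(2)[OF assms(2) X]]
      by (simp add: band_functional_def band_sum_def)
  qed
  then show ?thesis unfolding band_functional_def[of n "\<lambda>j. a j + act_shift b h k j"]
    by (intro restrict_ext) simp
qed

lemma act_shift_supp: "act_shift b h k \<in> supp_funs (arc_feet b)"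
  by (auto simp: act_shift_def supp_funs_def arc_feet_def arcs_def split: nat.splits)

text \<open>Outside the index range the matrix entry is unspecified, and the product vanishes
  because \<open>b j\<close> does.\<close>

lemma one_mat_superdiagonal:
  assumes "b \<in> supp_funs {..<n - 2}"
  shows "b j * 1\<^sub>m n $$ (Suc j, Suc (Suc j)) = (0 :: 'a::field)"
  using assms by (cases "j < n - 2") (auto simp: supp_funs_def)

lemma left_orbit_band:
  fixes b :: "nat \<Rightarrow> 'a::{field,finite}"
  assumes b: "b \<in> supp_funs {..<n - 2}"
  shows "left_orbit n (band_functional n a b) =
    (\<lambda>d. band_functional n (\<lambda>i. a i + d i) b) ` supp_funs (Suc ` arcs b)"
proof -
  have "act_shift b h (1\<^sub>m n) \<in> supp_funs (Suc ` arcs b)" for h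
    by (auto simp: act_shift_def one_mat_superdiagonal[OF b] supp_funs_def arcs_def image_iff
        split: nat.splits)
  moreover have "\<exists>h\<in>carrier (unitri n). d = act_shift b h (1\<^sub>m n)"
    if d: "d \<in> supp_funs (Suc ` arcs b)" for d
  proof (intro bexI ext)
    \<comment> \<open>Solves \<open>b i * h $$ (i, Suc i) = d (Suc i)\<close> for nonzero
      \<open>b i\<close>; where \<open>b i = 0\<close>, the value \<open>d (Suc i)\<close> is zero
      as well.\<close>
    define h where "h = superdiagonal n (\<lambda>i. d (Suc i) / b i)"
    show "h \<in> carrier (unitri n)" by (simp add: h_def)
    show "d j = act_shift b h (1\<^sub>m n) j" for j
    proof (cases j)
      case 0
      then show ?thesis using d by (auto simp: act_shift_def one_mat_superdiagonal[OF b] supp_funs_def)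
    next
      case (Suc i)
      show ?thesis
      proof (cases "b i = 0")
        case True
        then have "d j = 0" using d by (auto simp: supp_funs_def arcs_def Suc)
        then show ?thesis using True by (simp add: act_shift_def one_mat_superdiagonal[OF b] Suc)
      next
        case False
        then have "Suc i < n" using supp_funs_nonzeroD[OF b] by force
        then show ?thesis using False
          by (simp add: act_shift_def one_mat_superdiagonal[OF b] Suc h_def)
      qed
    qed
  qed
  ultimately have *: "supp_funs (Suc ` arcs b) = (\<lambda>h. act_shift b h (1\<^sub>m n)) ` carrier (unitri n)"
    by blast
  show ?thesis
    unfolding left_orbit_eq * image_image
    by (intro image_cong refl band_functional_act[OF _ one_unitri b])
qed

lemma two_sided_orbit_band:
  fixes b :: "nat \<Rightarrow> 'a::{field,finite}"
  assumes b: "b \<in> supp_funs {..<n - 2}"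
  shows "two_sided_orbit n (band_functional n a b) =
    (\<lambda>d. band_functional n (\<lambda>i. a i + d i) b) ` supp_funs (arc_feet b)"
proof -
  have "\<exists>h\<in>carrier (unitri n). \<exists>k\<in>carrier (unitri n). d = act_shift b h k"
    if d: "d \<in> supp_funs (arc_feet b)" for d
  proof (intro bexI ext)
    \<comment> \<open>An index j with \<open>b j\<close> and \<open>b (j - 1)\<close> both nonzero
      can be moved from either side. There \<open>k\<close> does all the work and \<open>h\<close>
      contributes zero. The shift by 1 in \<open>k\<close> accounts for \<open>act_shift\<close>
      using its entry at (j + 1, j + 2).\<close>
    define h where "h = superdiagonal n (\<lambda>i. if b (Suc i) = 0 then d (Suc i) / b i else 0)"
    define k where "k = superdiagonal n (\<lambda>i. d (i - 1) / b (i - 1))"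
    have lt: "Suc (Suc i) < n" if "b i \<noteq> 0" for i
      using supp_funs_nonzeroD[OF b that] by simp
    show "d j = act_shift b h k j" for j
    proof (cases "b j = 0")
      case bj: True
      show ?thesis
      proof (cases "j \<in> arc_feet b")
        case True
        then obtain i where "j = Suc i" "b i \<noteq> 0" using bj by (auto simp: arc_feet_def arcs_def)
        then show ?thesis using lt[of i] bj by (simp add: act_shift_def h_def)
      next
        case False
        then show ?thesis using d act_shift_supp[of b h k] by (simp add: supp_funs_def)
      qed
    next
      case False
      then have "b j * k $$ (Suc j, Suc (Suc j)) = d j" using lt[of j] by (simp add: k_def)
      moreover have "b i * h $$ (i, Suc i) = 0" if "j = Suc i" for i
        using that False lt[of i] by (cases "b i = 0") (simp_all add: h_def)
      ultimately show ?thesis by (auto simp: act_shift_def split: nat.splits)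
    qed
    show "h \<in> carrier (unitri n)" "k \<in> carrier (unitri n)" by (simp_all add: h_def k_def)
  qed
  then have *: "supp_funs (arc_feet b) =
      (\<lambda>(h, k). act_shift b h k) ` (carrier (unitri n) \<times> carrier (unitri n))"
    using act_shift_supp by (fastforce simp: image_iff)
  show ?thesis
    unfolding two_sided_orbit_eq * image_image
    by (intro image_cong refl) (auto simp: band_functional_act[OF _ _ b])
qed

lemma inj_on_band_functional_add:
  assumes "T \<subseteq> {..<n - 1}"
  shows "inj_on (\<lambda>d. band_functional n (\<lambda>i. a i + d i) b) (supp_funs T)"
proof (rule inj_onI, rule ext)
  fix d d' i
  assume d: "d \<in> supp_funs T" "d' \<in> supp_funs T"
    and eq: "band_functional n (\<lambda>i. a i + d i) b = band_functional n (\<lambda>i. a i + d' i) b"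
  show "d i = d' i"
    using d eq assms by (cases "i \<in> T") (auto simp: band_functional_eq_iff supp_funs_def)
qed

section \<open>Values of supercharacters and the norm condition\<close>

lemma band_sum_minus_one:
  assumes "g \<in> carrier (unitri n)"
  shows "band_sum n a b (g - 1\<^sub>m n) = band_sum n a b g"
  unfolding band_sum_def using unitriD[OF assms] by (auto intro!: arg_cong2[of _ _ _ _ "(+)"] sum.cong)

lemma band_sum_add:
  assumes "T \<subseteq> {..<n - 1}" "d \<in> supp_funs T"
  shows "band_sum n (\<lambda>i. a i + d i) b g = band_sum n a b g + (\<Sum>i\<in>T. d i * g $$ (i, Suc i))"
proof -
  have "(\<Sum>i<n - 1. d i * g $$ (i, Suc i)) = (\<Sum>i\<in>T. d i * g $$ (i, Suc i))"
    using assms by (intro sum.mono_neutral_right) (auto simp: supp_funs_def)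
  then show ?thesis by (simp add: band_sum_def distrib_right sum.distrib)
qed

text \<open>The two-sided orbit consists of all changes of \<open>a\<close> on F, so the sum over it
  is a full character sum in the entries of \<open>g\<close> at F. When nonzero, its value q^|F|
  cancels against the orbit size, and the size q^|S| of the left orbit remains.\<close>

lemma supercharacter_band:
  fixes \<theta> :: "'a::{field,finite} \<Rightarrow> complex"
  assumes \<theta>: "nontrivial_additive_character \<theta>"
    and b: "b \<in> supp_funs {..<n - 2}" and g: "g \<in> carrier (unitri n)"
  shows "supercharacter \<theta> n (band_functional n a b) g =
    (if \<forall>i\<in>arc_feet b. g $$ (i, Suc i) = 0
     then of_nat (CARD('a) ^ card (arcs b)) * \<theta> (band_sum n a b g) else 0)"
proof -
  note fin = finite_arcs[OF b] finite_arc_feet[OF b]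
  have sub: "Suc ` arcs b \<subseteq> {..<n - 1}" using arc_feet_subset[OF b] by (simp add: arc_feet_def)
  have L: "card (left_orbit n (band_functional n a b)) = CARD('a) ^ card (arcs b)"
    unfolding left_orbit_band[OF b] card_image[OF inj_on_band_functional_add[OF sub]]
    using fin by (simp add: card_supp_funs card_image)
  note inj = inj_on_band_functional_add[OF arc_feet_subset[OF b]]
  have R: "card (two_sided_orbit n (band_functional n a b)) = CARD('a) ^ card (arc_feet b)"
    unfolding two_sided_orbit_band[OF b] card_image[OF inj]
    using fin by (simp add: card_supp_funs)
  have "(\<Sum>m\<in>two_sided_orbit n (band_functional n a b). theta_fun \<theta> n m g) =
      (\<Sum>d\<in>supp_funs (arc_feet b). \<theta> (band_sum n (\<lambda>i. a i + d i) b g))"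
    unfolding two_sided_orbit_band[OF b] sum.reindex[OF inj] theta_fun_def
    using unitriD(4)[OF g] by (simp add: band_functional_def band_sum_minus_one[OF g])
  also have "\<dots> = \<theta> (band_sum n a b g) *
      (\<Sum>d\<in>supp_funs (arc_feet b). \<theta> (\<Sum>i\<in>arc_feet b. d i * g $$ (i, Suc i)))"
    by (simp add: band_sum_add[OF arc_feet_subset[OF b]] add_char_add[OF \<theta>] sum_distrib_left)
  finally show ?thesis
    using g by (simp add: supercharacter_def L R sum_add_char_supp_funs[OF \<theta> fin(2)])
qed

text \<open>Reading the entries at (i, i + 1) for i in \<open>T\<close> is a homomorphism onto
  F_q^T. The set on the right is its kernel, and superdiagonal matrices supported on
  \<open>T\<close> represent the cosets.\<close>

lemma card_superdiagonal_vanishing: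
  assumes "T \<subseteq> {..<n - 1}"
  shows "card (carrier (unitri n :: 'a::{field,finite} mat monoid)) =
    CARD('a) ^ card T * card {g \<in> carrier (unitri n :: 'a mat monoid). \<forall>i\<in>T. g $$ (i, Suc i) = 0}"
proof -
  define K where "K = {g \<in> carrier (unitri n :: 'a mat monoid). \<forall>i\<in>T. g $$ (i, Suc i) = 0}"
  have lt: "Suc i < n" if "i \<in> T" for i using assms that by auto
  have "bij_betw (\<lambda>(d, k). superdiagonal n d * k) (supp_funs T \<times> K) (carrier (unitri n))"
    unfolding bij_betw_def
  proof
    show "inj_on (\<lambda>(d, k). superdiagonal n d * k) (supp_funs T \<times> K)"
    proof (rule inj_onI, clarify)
      fix d k d' k'
      assume d: "d \<in> supp_funs T" "d' \<in> supp_funs T" and k: "k \<in> K" "k' \<in> K"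
        and eq: "superdiagonal n d * k = superdiagonal n d' * k'"
      have kc: "k \<in> carrier (unitri n)" "k' \<in> carrier (unitri n)" using k by (auto simp: K_def)
      have "d i = d' i" for i
      proof (cases "i \<in> T")
        case True
        have "(superdiagonal n d * k) $$ (i, Suc i) = (superdiagonal n d' * k') $$ (i, Suc i)"
          by (simp only: eq)
        then show ?thesis
          unfolding unitri_mult_index(1)[OF superdiagonal_closed kc(1) lt[OF True]]
            unitri_mult_index(1)[OF superdiagonal_closed kc(2) lt[OF True]]
          using k True lt[OF True] by (simp add: K_def)
      next
        case False
        then show ?thesis using d by (simp add: supp_funs_def)
      qed
      then have "d = d'" by blast
      then show "d = d' \<and> k = k'"
        using eq kc unitri.Units_l_cancel[of "superdiagonal n d" n k k'] by simp
    qed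
  next
    show "(\<lambda>(d, k). superdiagonal n d * k) ` (supp_funs T \<times> K) = carrier (unitri n)"
    proof (intro equalityI subsetI)
      fix g assume "g \<in> (\<lambda>(d, k). superdiagonal n d * k) ` (supp_funs T \<times> K)"
      then show "g \<in> carrier (unitri n)" by (auto simp: K_def unitri_mult_closed)
    next
      fix g :: "'a mat" assume g: "g \<in> carrier (unitri n)"
      define d where "d i = (if i \<in> T then g $$ (i, Suc i) else 0)" for i
      define k where "k = inv\<^bsub>unitri n\<^esub> (superdiagonal n d) * g"
      have inv: "inv\<^bsub>unitri n\<^esub> (superdiagonal n d) \<in> carrier (unitri n)" by simp
      have "k \<in> K"
        using lt by (auto simp: K_def k_def unitri_mult_closed[OF inv g] unitri_mult_index[OF inv g]
            unitri_inv_index d_def simp del: index_mult_mat(1))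
      moreover have "g = superdiagonal n d * k"
        using unitri.inv_solve_left[of k n "superdiagonal n d" g] g
          unitri_mult_closed[OF inv g] by (simp add: k_def)
      moreover have "d \<in> supp_funs T" by (simp add: d_def supp_funs_def)
      ultimately show "g \<in> (\<lambda>(d, k). superdiagonal n d * k) ` (supp_funs T \<times> K)" by auto
    qed
  qed
  from bij_betw_same_card[OF this] show ?thesis
    using finite_subset[OF assms] by (simp add: card_cartesian_product card_supp_funs K_def)
qed

text \<open>The norm relation gives |G| = q^(2|S|) |K| and counting cosets gives |G| = q^|F| |K|.
  Since |F| is 2|S| minus the size of the intersection of S and S + 1, that intersection is
  empty.\<close>

lemma arcs_nonadjacent_if_irreducible:
  fixes \<theta> :: "'a::{field,finite} \<Rightarrow> complex"
  assumes \<theta>: "nontrivial_additive_character \<theta>" and b: "b \<in> supp_funs {..<n - 2}"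
    and irr: "supercharacter \<theta> n (band_functional n a b) \<in> irreducible_characters (unitri n)"
  shows "arcs b \<inter> Suc ` arcs b = {}"
proof -
  define G where "G = (unitri n :: 'a mat monoid)"
  define \<chi> where "\<chi> = supercharacter \<theta> n (band_functional n a b)"
  define K where "K = {g \<in> carrier G. \<forall>i\<in>arc_feet b. g $$ (i, Suc i) = 0}"
  define q where "q = CARD('a)"
  have "card {0, 1 :: 'a} \<le> q" unfolding q_def by (rule card_mono) auto
  then have q: "q > 1" by simp
  have fin: "finite (carrier G)" by (simp add: G_def finite_unitri)
  have lt: "Suc i < n" if "i \<in> arc_feet b" for i using arc_feet_subset[OF b] that by auto
  have "\<chi> g * \<chi> (inv\<^bsub>G\<^esub> g) = (if g \<in> K then of_nat (q ^ (2 * card (arcs b))) else 0)"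
    if g: "g \<in> carrier G" for g
  proof -
    have gi: "inv\<^bsub>G\<^esub> g \<in> carrier (unitri n)" and g': "g \<in> carrier (unitri n)"
      using g by (simp_all add: G_def)
    have "(\<forall>i\<in>arc_feet b. (inv\<^bsub>G\<^esub> g) $$ (i, Suc i) = 0) \<longleftrightarrow> g \<in> K"
      using g lt by (auto simp: K_def G_def unitri_inv_index)
    moreover have "band_sum n a b g + band_sum n a b (inv\<^bsub>G\<^esub> g) = 0" if "g \<in> K"
    proof -
      \<comment> \<open>The quadratic term in this entry of the inverse has the factor
        \<open>g $$ (i, Suc i)\<close>, which vanishes at an arc because \<open>g\<close> lies in
        \<open>K\<close>.\<close>
      have "b i * (inv\<^bsub>G\<^esub> g) $$ (i, Suc (Suc i)) = - (b i * g $$ (i, Suc (Suc i)))"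
        if "i < n - 2" for i
        using that \<open>g \<in> K\<close> g
        by (cases "b i = 0") (auto simp: G_def K_def unitri_inv_index arc_feet_def arcs_def)
      moreover have "a i * (inv\<^bsub>G\<^esub> g) $$ (i, Suc i) = - (a i * g $$ (i, Suc i))"
        if "i < n - 1" for i
        using that g by (auto simp: G_def unitri_inv_index)
      ultimately show ?thesis by (simp add: band_sum_def sum_negf)
    qed
    ultimately show ?thesis
      unfolding \<chi>_def supercharacter_band[OF \<theta> b g'] supercharacter_band[OF \<theta> b gi]
      using g
      by (auto simp: K_def q_def power_add mult_2 simp flip: add_char_add[OF \<theta>] simp: add_char_zero[OF \<theta>])
  qed
  then have "(\<Sum>g\<in>carrier G. \<chi> g * \<chi> (inv\<^bsub>G\<^esub> g)) =
      (\<Sum>g\<in>carrier G. if g \<in> K then of_nat (q ^ (2 * card (arcs b))) else 0)"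
    by (intro sum.cong) auto
  also have "\<dots> = of_nat (card K * q ^ (2 * card (arcs b)))"
    using fin by (simp add: sum.If_cases K_def Int_def conj_commute)
  finally have "of_nat (card (carrier G)) = (of_nat (card K * q ^ (2 * card (arcs b))) :: complex)"
    using irreducible_character_norm[OF _ fin, of \<chi>] irr by (simp add: G_def \<chi>_def group_unitri)
  then have "q ^ card (arc_feet b) * card K = card K * q ^ (2 * card (arcs b))"
    using card_superdiagonal_vanishing[OF arc_feet_subset[OF b], where 'a='a]
    by (simp add: K_def G_def q_def of_nat_eq_iff del: of_nat_mult of_nat_power)
  moreover have "1\<^sub>m n $$ (i, Suc i) = (0 :: 'a)" if "i \<in> arc_feet b" for i using lt[OF that] by simp
  then have "1\<^sub>m n \<in> K" by (simp add: K_def G_def)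
  then have "card K > 0" using fin by (auto simp: card_gt_0_iff K_def)
  ultimately have "q ^ card (arc_feet b) = q ^ (2 * card (arcs b))" by simp
  then have "card (arc_feet b) = 2 * card (arcs b)" using q by simp
  moreover have "card (arcs b) + card (Suc ` arcs b) = card (arc_feet b) + card (arcs b \<inter> Suc ` arcs b)"
    unfolding arc_feet_def using finite_arcs[OF b] by (intro card_Un_Int) auto
  ultimately have "card (arcs b \<inter> Suc ` arcs b) = 0" by (simp add: card_image)
  then show ?thesis using finite_arcs[OF b] by simp
qed

section \<open>The lower central series\<close>

text \<open>Trades inverses for an equation between products, so that matrix commutators can be
  checked entry by entry.\<close>

lemma (in group) eq_commutatorI:
  assumes "h \<in> carrier G" "k \<in> carrier G" "z \<in> carrier G" "z \<otimes> k \<otimes> h = h \<otimes> k"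
  shows "z = h \<otimes> k \<otimes> inv h \<otimes> inv k"
proof -
  have "h \<otimes> k \<otimes> inv h \<otimes> inv k = z \<otimes> k \<otimes> (h \<otimes> inv h) \<otimes> inv k"
    using assms by (simp add: m_assoc flip: assms(4))
  also have "\<dots> = z" using assms by (simp add: m_assoc del: Units_r_inv)
  finally show ?thesis by simp
qed

text \<open>Left multiplication by a transvection is an elementary row addition.\<close>

lemma transvection_mult_index:
  assumes "A \<in> carrier_mat n n" "r < n" "c < n" "j < n" "i < j"
  shows "(transvection n i j t * A) $$ (r, c) = A $$ (r, c) + (if r = i then t * A $$ (j, c) else 0)"
proof -
  have "transvection n i j t = addrow_mat n t i j"
    using assms by (intro eq_matI) (auto simp: transvection_def elementary_def addrow_mat_def)
  then have "transvection n i j t * A = addrow t i j A" using addrow_mat[OF assms(1,4)] by simp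
  then show ?thesis using assms by (simp add: add.commute)
qed

text \<open>The Steinberg commutator relation, in the inverse-free form of
  \<open>eq_commutatorI\<close>.\<close>

lemma transvection_commutator:
  fixes s t :: "'a::{field,finite}"
  assumes "i < j" "j < k" "k < n"
  shows "transvection n i k (s * t) * transvection n j k t * transvection n i j s =
    transvection n i j s * transvection n j k t"
proof (rule eq_matI)
  have cl: "transvection n i j s \<in> carrier_mat n n" "transvection n j k t \<in> carrier_mat n n"
    "transvection n i k (s * t) \<in> carrier_mat n n"
    by (simp_all add: transvection_def elementary_def)
  note cl' = mult_carrier_mat[OF cl(2,1)]
  fix r c
  assume "r < dim_row (transvection n i j s * transvection n j k t)"
    "c < dim_col (transvection n i j s * transvection n j k t)"
  then have rc: "r < n" "c < n" using cl by auto
  have lt: "i < n" "j < n" "i < k" using assms by auto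
  show "(transvection n i k (s * t) * transvection n j k t * transvection n i j s) $$ (r, c) =
      (transvection n i j s * transvection n j k t) $$ (r, c)"
    using rc assms lt
    by (simp add: assoc_mult_mat[OF cl(3,2,1)] transvection_mult_index[OF cl(1)]
        transvection_mult_index[OF cl(2)] transvection_mult_index[OF cl'] del: index_mult_mat(1))
      (auto simp: transvection_def elementary_def algebra_simps)
qed (simp_all add: transvection_def elementary_def)

text \<open>\<open>H\<close> is kept general so that the step can be iterated along the lower
  central series. The first factor carries the parameter \<open>t\<close>, so a transvection with
  parameter 1 in \<open>H\<close> suffices.\<close>

lemma transvection_mem_commutator_subgroup:
  fixes t :: "'a::{field,finite}"
  assumes "i < j" "j < k" "k < n" "transvection n j k 1 \<in> H"
  shows "transvection n i k t \<in> commutator_subgroup (unitri n) (carrier (unitri n)) H"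
proof -
  have "transvection n i k t = transvection n i j t * transvection n j k 1 *
      inv\<^bsub>unitri n\<^esub> (transvection n i j t) * inv\<^bsub>unitri n\<^esub> (transvection n j k 1)"
    using assms transvection_commutator[OF assms(1-3), of t 1]
      unitri.eq_commutatorI[of "transvection n i j t" n "transvection n j k 1" "transvection n i k t"]
    by simp
  then show ?thesis
    unfolding commutator_subgroup_def
    using assms by (intro generate.incl) (auto intro!: exI)
qed

text \<open>Two nested commutators go through the intermediate indices i + 1 and i + 2, and i + 3
  \<le> k leaves a transvection from i + 2 to k.\<close>

lemma transvection_mem_lower_central:
  fixes t :: "'a::{field,finite}"
  assumes "i + 3 \<le> k" "k < n"
  shows "transvection n i k t \<in> commutator_subgroup (unitri n) (carrier (unitri n))
    (commutator_subgroup (unitri n) (carrier (unitri n)) (carrier (unitri n)))"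
  using assms
  by (intro transvection_mem_commutator_subgroup[of i "Suc i"]
      transvection_mem_commutator_subgroup[of "Suc i" "Suc (Suc i)"]) auto

lemma commutator_subgroup_subset:
  fixes L :: "'a::{field,finite} mat set"
  assumes "subgroup L (unitri n)" "H \<subseteq> carrier (unitri n)"
    and "\<And>h k z. h \<in> carrier (unitri n) \<Longrightarrow> k \<in> H \<Longrightarrow> z \<in> carrier (unitri n) \<Longrightarrow>
      z * k * h = h * k \<Longrightarrow> z \<in> L"
  shows "commutator_subgroup (unitri n) (carrier (unitri n)) H \<subseteq> L"
  unfolding commutator_subgroup_def
proof (rule unitri.generate_subgroup_incl[OF _ assms(1)], clarify)
  fix h k :: "'a mat"
  assume h: "h \<in> carrier (unitri n)" and k: "k \<in> H"
  then have k': "k \<in> carrier (unitri n)" using assms(2) by auto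
  note cl = h k' unitri.inv_closed[OF h] unitri.inv_closed[OF k']
  let ?z = "h \<otimes>\<^bsub>unitri n\<^esub> k \<otimes>\<^bsub>unitri n\<^esub> inv\<^bsub>unitri n\<^esub> h \<otimes>\<^bsub>unitri n\<^esub> inv\<^bsub>unitri n\<^esub> k"
  have z: "?z \<in> carrier (unitri n)" using cl by (intro unitri.m_closed)
  have "?z \<otimes>\<^bsub>unitri n\<^esub> k \<otimes>\<^bsub>unitri n\<^esub> h = h \<otimes>\<^bsub>unitri n\<^esub> k"
    using cl by (simp add: unitri.m_assoc del: unitri_simps)
  then show "?z \<in> L" using assms(3)[OF h k z] by simp
qed

text \<open>Commutators vanish on the first superdiagonal, which is additive. On the second, [h, k]
  has the entry h_{i,i+1} k_{i+1,i+2} - k_{i,i+1} h_{i+1,i+2}, which vanishes once \<open>k\<close>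
  is itself in the commutator subgroup.\<close>

lemma lower_central_subset:
  "commutator_subgroup (unitri n) (carrier (unitri n))
     (commutator_subgroup (unitri n) (carrier (unitri n)) (carrier (unitri n :: 'a::{field,finite} mat monoid)))
   \<subseteq> {g \<in> carrier (unitri n). (\<forall>i. Suc i < n \<longrightarrow> g $$ (i, Suc i) = 0) \<and>
        (\<forall>i. Suc (Suc i) < n \<longrightarrow> g $$ (i, Suc (Suc i)) = 0)}"
    (is "commutator_subgroup _ _ ?C \<subseteq> ?L3")
proof -
  let ?L2 = "{g \<in> carrier (unitri n :: 'a mat monoid). \<forall>i. Suc i < n \<longrightarrow> g $$ (i, Suc i) = 0}"
  have L2: "subgroup ?L2 (unitri n)"
    by (rule unitri.subgroupI)
      (auto simp: unitri_inv_index unitri_mult_index unitri_mult_closed simp del: index_mult_mat(1)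
        intro!: exI[of _ "1\<^sub>m n"])
  have L3: "subgroup ?L3 (unitri n)"
    by (rule unitri.subgroupI)
      (auto simp: unitri_inv_index unitri_mult_index unitri_mult_closed simp del: index_mult_mat(1)
        intro!: exI[of _ "1\<^sub>m n"])
  have eqs: "Suc i < n \<Longrightarrow> z $$ (i, Suc i) = 0"
    "Suc (Suc i) < n \<Longrightarrow> (\<And>i. Suc i < n \<Longrightarrow> k $$ (i, Suc i) = 0) \<Longrightarrow> z $$ (i, Suc (Suc i)) = 0"
    if h: "h \<in> carrier (unitri n)" and k: "k \<in> carrier (unitri n)" and z: "z \<in> carrier (unitri n)"
      and eq: "z * k * h = h * k" for h k z :: "'a mat" and i
  proof -
    note idx = unitri_mult_index[OF unitri_mult_closed[OF z k] h] unitri_mult_index[OF z k]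
      unitri_mult_index[OF h k]
    show 1: "z $$ (i, Suc i) = 0" if "Suc i < n" for i
      using idx(1)[OF that] idx(3)[OF that] idx(5)[OF that] unfolding eq
      by (simp del: index_mult_mat(1))
    show "z $$ (i, Suc (Suc i)) = 0" if "Suc (Suc i) < n" "\<And>i. Suc i < n \<Longrightarrow> k $$ (i, Suc i) = 0"
      using idx(2)[OF that(1)] idx(4)[OF that(1)] idx(6)[OF that(1)] idx(3)[of i] that 1 unfolding eq
      by (simp del: index_mult_mat(1))
  qed
  have C: "?C \<subseteq> ?L2"
    by (rule commutator_subgroup_subset[OF L2]) (use eqs(1) in auto)
  show ?thesis
  proof (rule commutator_subgroup_subset[OF L3])
    show "?C \<subseteq> carrier (unitri n)" using C by auto
    fix h k z :: "'a mat"
    assume h: "h \<in> carrier (unitri n)" and k: "k \<in> ?C" and z: "z \<in> carrier (unitri n)"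
      and eq: "z * k * h = h * k"
    have k': "k \<in> carrier (unitri n)" "\<And>i. Suc i < n \<Longrightarrow> k $$ (i, Suc i) = 0"
      using k C by auto
    show "z \<in> ?L3" using z eqs(1)[OF h k'(1) z eq] eqs(2)[OF h k'(1) z eq _ k'(2)] by simp
  qed
qed

text \<open>The supercharacter takes its value at 1 on all transvections at (i, k) with k \<ge> i +
  3. Averaging over their parameter forces every functional in the orbit to vanish on the
  corresponding elementary matrix.\<close>

lemma band_functional_if_lower_central_in_kernel:
  fixes \<theta> :: "'a::{field,finite} \<Rightarrow> complex"
  assumes \<theta>: "nontrivial_additive_character \<theta>" and l: "l \<in> dual n"
    and ker: "commutator_subgroup (unitri n) (carrier (unitri n))
      (commutator_subgroup (unitri n) (carrier (unitri n)) (carrier (unitri n)))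
      \<subseteq> char_kernel (unitri n) (supercharacter \<theta> n l)"
  shows "\<exists>a b. a \<in> supp_funs {..<n - 1} \<and> b \<in> supp_funs {..<n - 2} \<and> l = band_functional n a b"
proof (rule band_functional_if_vanishing[OF l])
  fix i k assume ik: "i + 3 \<le> k" "k < n"
  then have lt: "i < k" by simp
  define M where "M = two_sided_orbit n l"
  have fin: "finite M"
    unfolding M_def two_sided_orbit_eq by (intro finite_imageI finite_cartesian_product finite_unitri)
  have M_dual: "m \<in> dual n" if "m \<in> M" for m
    using that dual_act[OF l] by (auto simp: M_def two_sided_orbit_eq)
  have "restrict (\<lambda>X. l (1\<^sub>m n * (X * 1\<^sub>m n))) (strictly_upper n) = l"
  proof (rule extensionalityI[OF _ dualD(1)[OF l]])
    fix X :: "'a mat" assume "X \<in> strictly_upper n"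
    then show "restrict (\<lambda>X. l (1\<^sub>m n * (X * 1\<^sub>m n))) (strictly_upper n) X = l X"
      using strictly_upperD(1)[of X n] by simp
  qed simp
  then have lM: "l \<in> M"
    unfolding M_def two_sided_orbit_eq by (intro image_eqI[of _ _ "(1\<^sub>m n, 1\<^sub>m n)"]) auto
  have "left_orbit n l \<noteq> {}" "finite (left_orbit n l)"
    unfolding left_orbit_eq using one_unitri by (blast, intro finite_imageI finite_unitri)
  then have nz: "card (left_orbit n l) \<noteq> 0" "card M \<noteq> 0"
    using fin lM by auto
  have "(\<Sum>m\<in>M. \<theta> (t * m (elementary n i k 1))) = of_nat (card M)" for t
  proof -
    let ?g = "transvection n i k t"
    have "supercharacter \<theta> n l ?g = supercharacter \<theta> n l (1\<^sub>m n)"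
      using ker transvection_mem_lower_central[OF ik, of t] by (auto simp: char_kernel_def)
    then have "(\<Sum>m\<in>M. theta_fun \<theta> n m ?g) = (\<Sum>m\<in>M. theta_fun \<theta> n m (1\<^sub>m n))"
      using nz lt by (simp add: supercharacter_def flip: M_def)
    moreover have "theta_fun \<theta> n m ?g = \<theta> (t * m (elementary n i k 1))" if "m \<in> M" for m
      using dual_elementary[OF M_dual[OF that] lt, of t] by (simp add: theta_fun_def)
    moreover have "theta_fun \<theta> n m (1\<^sub>m n) = 1" if "m \<in> M" for m
    proof -
      have eq: "1\<^sub>m n - 1\<^sub>m n = (0\<^sub>m n n :: 'a mat)" by (intro eq_matI) auto
      show ?thesis
        unfolding theta_fun_def eq dual_zero[OF M_dual[OF that]] by (rule add_char_zero[OF \<theta>])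
    qed
    ultimately show ?thesis by simp
  qed
  \<comment> \<open>Exchanging the sums and using orthogonality in \<open>t\<close> counts the
    members of \<open>M\<close> that vanish at (i, k); the count equals the size of
    \<open>M\<close>.\<close>
  then have "of_nat (CARD('a) * card M) = (\<Sum>t\<in>UNIV. \<Sum>m\<in>M. \<theta> (t * m (elementary n i k 1)))"
    by simp
  also have "\<dots> = (\<Sum>m\<in>M. \<Sum>t\<in>UNIV. \<theta> (t * m (elementary n i k 1)))"
    by (rule sum.swap)
  also have "\<dots> = of_nat (CARD('a) * card {m \<in> M. m (elementary n i k 1) = 0})"
    using fin by (simp add: sum_add_char_UNIV[OF \<theta>] sum.If_cases Int_def)
  finally have "card {m \<in> M. m (elementary n i k 1) = 0} = card M"
    by (simp only: of_nat_eq_iff) simp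
  then have "{m \<in> M. m (elementary n i k 1) = 0} = M"
    using fin by (intro card_subset_eq) auto
  then show "l (elementary n i k 1) = 0" using lM by blast
qed

lemma lower_central_in_kernel:
  fixes \<theta> :: "'a::{field,finite} \<Rightarrow> complex"
  assumes \<theta>: "nontrivial_additive_character \<theta>" and b: "b \<in> supp_funs {..<n - 2}"
  shows "commutator_subgroup (unitri n) (carrier (unitri n))
      (commutator_subgroup (unitri n) (carrier (unitri n)) (carrier (unitri n)))
      \<subseteq> char_kernel (unitri n) (supercharacter \<theta> n (band_functional n a b))"
proof (rule order_trans[OF lower_central_subset], clarify)
  fix g :: "'a mat" assume g: "g \<in> carrier (unitri n)"
    and 1: "\<forall>i. Suc i < n \<longrightarrow> g $$ (i, Suc i) = 0"
    and 2: "\<forall>i. Suc (Suc i) < n \<longrightarrow> g $$ (i, Suc (Suc i)) = 0"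
  have lt: "Suc i < n" if "i \<in> arc_feet b" for i using arc_feet_subset[OF b] that by auto
  have "band_sum n a b g = 0" "band_sum n a b (1\<^sub>m n) = 0"
    using 1 2 by (auto simp: band_sum_def intro!: sum.neutral)
  moreover have "1\<^sub>m n $$ (i, Suc i) = (0 :: 'a)" "g $$ (i, Suc i) = 0" if "i \<in> arc_feet b" for i
    using lt[OF that] 1 by simp_all
  ultimately show "g \<in> char_kernel (unitri n) (supercharacter \<theta> n (band_functional n a b))"
    using g by (simp add: char_kernel_def supercharacter_band[OF \<theta> b])
qed

section \<open>Irreducible representations with Heisenberg supercharacters\<close>

definition heis_shift :: "(nat \<Rightarrow> 'a) \<Rightarrow> 'a::field mat \<Rightarrow> (nat \<Rightarrow> 'a) \<Rightarrow> nat \<Rightarrow> 'a" where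
  "heis_shift b g v = (\<lambda>s. if s \<in> arcs b then v s + g $$ (s, Suc s) else 0)"

text \<open>The multiplier of a monomial representation: at v = 0 it is \<theta>_\<lambda>(g), and
  the sum over the arcs makes it a cocycle for \<open>heis_shift\<close>.\<close>

definition heis_phase ::
  "('a \<Rightarrow> complex) \<Rightarrow> nat \<Rightarrow> (nat \<Rightarrow> 'a) \<Rightarrow> (nat \<Rightarrow> 'a) \<Rightarrow> 'a::field mat \<Rightarrow> (nat \<Rightarrow> 'a) \<Rightarrow> complex"
where
  "heis_phase \<theta> n a b g v =
     \<theta> (band_sum n a b g + (\<Sum>s\<in>arcs b. v s * (b s * g $$ (Suc s, Suc (Suc s)))))"

text \<open>
  The representation on functions \<open>f\<close> on \<open>supp_funs (arcs b)\<close> given by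
  \<open>(g f)(v) = heis_phase g v * f (heis_shift g v)\<close>, where \<open>e\<close> enumerates the arguments \<open>v\<close>.
\<close>

definition heis_rep ::
  "('a \<Rightarrow> complex) \<Rightarrow> nat \<Rightarrow> (nat \<Rightarrow> 'a) \<Rightarrow> (nat \<Rightarrow> 'a) \<Rightarrow> (nat \<Rightarrow> nat \<Rightarrow> 'a) \<Rightarrow>
     'a::field mat \<Rightarrow> complex mat" where
  "heis_rep \<theta> n a b e g =
     mat (CARD('a) ^ card (arcs b)) (CARD('a) ^ card (arcs b))
       (\<lambda>(i, j). if e j = heis_shift b g (e i) then heis_phase \<theta> n a b g (e i) else 0)"

context
  fixes \<theta> :: "'a::{field,finite} \<Rightarrow> complex" and n :: nat and a b :: "nat \<Rightarrow> 'a"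
  assumes \<theta>: "nontrivial_additive_character \<theta>" and b: "b \<in> supp_funs {..<n - 2}"
begin

private lemma arcs_lt: "s \<in> arcs b \<Longrightarrow> Suc (Suc s) < n"
  using arcs_subset[OF b] by auto

lemma heis_shift_closed: "heis_shift b g v \<in> supp_funs (arcs b)"
  by (simp add: heis_shift_def supp_funs_def)

lemma heis_shift_mult:
  assumes "g \<in> carrier (unitri n)" "h \<in> carrier (unitri n)"
  shows "heis_shift b (g * h) v = heis_shift b h (heis_shift b g v)"
  using arcs_lt by (auto simp: heis_shift_def fun_eq_iff unitri_mult_index[OF assms] Suc_lessD
      simp del: index_mult_mat(1))

lemma heis_shift_one: "v \<in> supp_funs (arcs b) \<Longrightarrow> heis_shift b (1\<^sub>m n) v = v"
  using arcs_lt by (force simp: heis_shift_def fun_eq_iff supp_funs_def)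

text \<open>The cocycle identity. The mixed terms
  \<open>g $$ (s, Suc s) * h $$ (Suc s, Suc (Suc s))\<close> in the product are exactly what the
  translation of \<open>v\<close> by \<open>g\<close> adds to the phase of \<open>h\<close>.\<close>

lemma heis_phase_mult:
  assumes g: "g \<in> carrier (unitri n)" and h: "h \<in> carrier (unitri n)"
  shows "heis_phase \<theta> n a b (g * h) v =
    heis_phase \<theta> n a b g v * heis_phase \<theta> n a b h (heis_shift b g v)"
proof -
  note fin = finite_arcs[OF b]
  have "(\<Sum>i<n - 2. b i * (g $$ (i, Suc i) * h $$ (Suc i, Suc (Suc i)))) =
      (\<Sum>s\<in>arcs b. b s * (g $$ (s, Suc s) * h $$ (Suc s, Suc (Suc s))))"
    using arcs_subset[OF b] by (intro sum.mono_neutral_right) (auto simp: arcs_def)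
  then have "band_sum n a b (g * h) = band_sum n a b g + band_sum n a b h +
      (\<Sum>s\<in>arcs b. b s * (g $$ (s, Suc s) * h $$ (Suc s, Suc (Suc s))))"
    by (simp add: band_sum_def unitri_mult_index[OF g h] distrib_left sum.distrib del: index_mult_mat(1))
  moreover have "(\<Sum>s\<in>arcs b. v s * (b s * (g * h) $$ (Suc s, Suc (Suc s)))) =
      (\<Sum>s\<in>arcs b. v s * (b s * g $$ (Suc s, Suc (Suc s)))) +
      (\<Sum>s\<in>arcs b. v s * (b s * h $$ (Suc s, Suc (Suc s))))"
    unfolding sum.distrib[symmetric]
    by (intro sum.cong refl) (simp add: unitri_mult_index[OF g h] arcs_lt distrib_left
        del: index_mult_mat(1))
  moreover have "(\<Sum>s\<in>arcs b. heis_shift b g v s * (b s * h $$ (Suc s, Suc (Suc s)))) =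
      (\<Sum>s\<in>arcs b. v s * (b s * h $$ (Suc s, Suc (Suc s)))) +
      (\<Sum>s\<in>arcs b. b s * (g $$ (s, Suc s) * h $$ (Suc s, Suc (Suc s))))"
    unfolding sum.distrib[symmetric]
    by (intro sum.cong refl) (simp add: heis_shift_def algebra_simps)
  ultimately show ?thesis
    unfolding heis_phase_def add_char_add[OF \<theta>, symmetric] by (simp add: algebra_simps)
qed

lemma heis_phase_one: "heis_phase \<theta> n a b (1\<^sub>m n) v = 1"
proof -
  have "band_sum n a b (1\<^sub>m n) = 0"
    by (auto simp: band_sum_def intro!: sum.neutral)
  moreover have "1\<^sub>m n $$ (Suc s, Suc (Suc s)) = (0 :: 'a)" if "s \<in> arcs b" for s
    using arcs_lt[OF that] by simp
  then have "(\<Sum>s\<in>arcs b. v s * (b s * 1\<^sub>m n $$ (Suc s, Suc (Suc s)))) = 0"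
    by (intro sum.neutral) simp
  ultimately show ?thesis by (simp add: heis_phase_def add_char_zero[OF \<theta>])
qed

context
  fixes e :: "nat \<Rightarrow> nat \<Rightarrow> 'a" and d :: nat
  defines "d \<equiv> CARD('a) ^ card (arcs b)"
  assumes e: "bij_betw e {..<d} (supp_funs (arcs b))"
begin

private abbreviation "\<rho> \<equiv> heis_rep \<theta> n a b e"

private lemma e_closed: "i < d \<Longrightarrow> e i \<in> supp_funs (arcs b)"
  using e by (auto simp: bij_betw_def)

private lemma e_eq_iff: "i < d \<Longrightarrow> j < d \<Longrightarrow> e i = e j \<longleftrightarrow> i = j"
  using e by (auto simp: bij_betw_def inj_on_eq_iff)

private lemma e_surj:
  assumes "v \<in> supp_funs (arcs b)"
  obtains i where "i < d" "e i = v"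
  using e assms unfolding bij_betw_def by (metis imageE lessThan_iff)

private lemma rep_index:
  "i < d \<Longrightarrow> j < d \<Longrightarrow> \<rho> g $$ (i, j) =
     (if e j = heis_shift b g (e i) then heis_phase \<theta> n a b g (e i) else 0)"
  by (simp add: heis_rep_def d_def)

private lemma rep_carrier: "\<rho> g \<in> carrier_mat d d"
  by (simp add: heis_rep_def d_def)

private lemma dim_rep: "dim_row (\<rho> g) = d" "dim_col (\<rho> g) = d"
  using rep_carrier[of g] by auto

lemma heis_rep_hom: "\<rho> \<in> hom (unitri n) (GL d)"
proof (rule representationI[OF group_unitri])
  fix g h :: "'a mat" assume g: "g \<in> carrier (unitri n)" and h: "h \<in> carrier (unitri n)"
  show "\<rho> (g \<otimes>\<^bsub>unitri n\<^esub> h) = \<rho> g * \<rho> h"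
  proof (rule eq_matI)
    fix i j assume "i < dim_row (\<rho> g * \<rho> h)" "j < dim_col (\<rho> g * \<rho> h)"
    then have ij: "i < d" "j < d" by (simp_all add: dim_rep)
    \<comment> \<open>Row \<open>i\<close> of \<open>\<rho> g\<close> has its only nonzero entry in
      column \<open>k\<close>, so the matrix product reduces to a single term.\<close>
    obtain k where k: "k < d" "e k = heis_shift b g (e i)"
      using e_surj[OF heis_shift_closed] by metis
    have "(\<rho> g * \<rho> h) $$ (i, j) = (\<Sum>l<d. \<rho> g $$ (i, l) * \<rho> h $$ (l, j))"
      using ij by (rule mult_mat_index[OF rep_carrier rep_carrier])
    also have "\<dots> = (\<Sum>l<d. if l = k then heis_phase \<theta> n a b g (e i) * \<rho> h $$ (k, j) else 0)"
      using ij by (intro sum.cong refl) (auto simp: rep_index k(1) e_eq_iff simp flip: k(2))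
    also have "\<dots> = \<rho> (g * h) $$ (i, j)"
      using ij k by (simp add: rep_index heis_shift_mult[OF g h] heis_phase_mult[OF g h])
    finally show "\<rho> (g \<otimes>\<^bsub>unitri n\<^esub> h) $$ (i, j) = (\<rho> g * \<rho> h) $$ (i, j)" by simp
  qed (simp_all add: dim_rep)
next
  show "\<rho> \<one>\<^bsub>unitri n\<^esub> = 1\<^sub>m d"
  proof (rule eq_matI)
    fix i j assume "i < dim_row (1\<^sub>m d)" "j < dim_col (1\<^sub>m d)"
    then show "\<rho> \<one>\<^bsub>unitri n\<^esub> $$ (i, j) = 1\<^sub>m d $$ (i, j)"
      by (simp add: rep_index heis_shift_one e_closed heis_phase_one e_eq_iff)
  qed (simp_all add: dim_rep)
qed (rule rep_carrier)

text \<open>A diagonal entry is nonzero only if \<open>g\<close> translates trivially, that is,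
  vanishes at S. Summing the phases over all \<open>v\<close> then forces \<open>g\<close> to vanish
  at S + 1, and together these are the conditions at F.\<close>

lemma trace_heis_rep:
  assumes g: "g \<in> carrier (unitri n)"
  shows "mat_trace (\<rho> g) = supercharacter \<theta> n (band_functional n a b) g"
proof -
  note fin = finite_arcs[OF b]
  have shift: "v = heis_shift b g v \<longleftrightarrow> (\<forall>s\<in>arcs b. g $$ (s, Suc s) = 0)"
    if "v \<in> supp_funs (arcs b)" for v
    using that by (auto simp: heis_shift_def fun_eq_iff supp_funs_def)
  have sum_if: "(\<Sum>v\<in>A. if Q then f v else 0) = (if Q then \<Sum>v\<in>A. f v else 0)"
    for Q A and f :: "(nat \<Rightarrow> 'a) \<Rightarrow> complex"
    by simp
  have "mat_trace (\<rho> g) = (\<Sum>i<d. \<rho> g $$ (i, i))"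
    using rep_carrier[of g] by (simp add: mat_trace_def)
  also have "\<dots> = (\<Sum>i<d. (\<lambda>v. if v = heis_shift b g v then heis_phase \<theta> n a b g v else 0) (e i))"
    by (simp add: rep_index)
  also have "\<dots> = (\<Sum>v\<in>supp_funs (arcs b). if v = heis_shift b g v then heis_phase \<theta> n a b g v else 0)"
    by (rule sum.reindex_bij_betw[OF e])
  also have "\<dots> = (\<Sum>v\<in>supp_funs (arcs b).
      if \<forall>s\<in>arcs b. g $$ (s, Suc s) = 0 then heis_phase \<theta> n a b g v else 0)"
    by (intro sum.cong refl) (simp only: shift)
  also have "\<dots> = (if \<forall>s\<in>arcs b. g $$ (s, Suc s) = 0
      then \<Sum>v\<in>supp_funs (arcs b). heis_phase \<theta> n a b g v else 0)"
    by (rule sum_if)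
  also have "(\<Sum>v\<in>supp_funs (arcs b). heis_phase \<theta> n a b g v) = \<theta> (band_sum n a b g) *
      (if \<forall>s\<in>arcs b. b s * g $$ (Suc s, Suc (Suc s)) = 0 then of_nat d else 0)"
    unfolding heis_phase_def add_char_add[OF \<theta>, of "band_sum n a b g"] sum_distrib_left[symmetric]
      sum_add_char_supp_funs[OF \<theta> fin] d_def ..
  also have "(\<forall>s\<in>arcs b. b s * g $$ (Suc s, Suc (Suc s)) = 0) \<longleftrightarrow>
      (\<forall>i\<in>Suc ` arcs b. g $$ (i, Suc i) = 0)"
    by (auto simp: arcs_def)
  finally show ?thesis
    unfolding supercharacter_band[OF \<theta> b g] by (auto simp: arc_feet_def d_def)
qed

text \<open>Entries of \<open>g\<close> at S + 1 give multiplications by characters that separate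
  the points of F_q^S; entries at S give translations, which permute the unit vectors transitively
  up to scalars. Disjointness of S and S + 1 lets the former occur without translation.\<close>

lemma irreducible_heis_rep:
  assumes disj: "arcs b \<inter> Suc ` arcs b = {}"
  shows "irreducible_representation (unitri n) d \<rho>"
  unfolding irreducible_representation_def
proof (intro conjI allI impI)
  show "\<rho> \<in> hom (unitri n) (GL d)" by (rule heis_rep_hom)
  show "d > 0" by (simp add: d_def)
  fix W
  assume "VectorSpace.subspace class_ring W (module_vec TYPE(complex) d) \<and>
    (\<forall>g\<in>carrier (unitri n). \<forall>w\<in>W. \<rho> g *\<^sub>v w \<in> W)"
  then have W: "W \<subseteq> carrier_vec d" "0\<^sub>v d \<in> W" "\<And>v w. v \<in> W \<Longrightarrow> w \<in> W \<Longrightarrow> v + w \<in> W"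
      "\<And>c v. v \<in> W \<Longrightarrow> c \<cdot>\<^sub>v v \<in> W"
    and inv: "\<And>g w. g \<in> carrier (unitri n) \<Longrightarrow> w \<in> W \<Longrightarrow> \<rho> g *\<^sub>v w \<in> W"
    unfolding subspace_module_vec_iff by auto
  have apply_rep: "(\<rho> g *\<^sub>v w) $ i = heis_phase \<theta> n a b g (e i) * w $ k"
    if "w \<in> carrier_vec d" "i < d" "k < d" "e k = heis_shift b g (e i)" for g w i k
  proof -
    have "(\<rho> g *\<^sub>v w) $ i = (\<Sum>l<d. \<rho> g $$ (i, l) * w $ l)"
      using that rep_carrier[of g] by (auto simp: scalar_prod_def atLeast0LessThan)
    also have "\<dots> = (\<Sum>l<d. if l = k then heis_phase \<theta> n a b g (e i) * w $ k else 0)"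
      using that by (intro sum.cong refl) (auto simp: rep_index e_eq_iff simp flip: that(4))
    finally show ?thesis using that by simp
  qed
  show "W = {0\<^sub>v d} \<or> W = carrier_vec d"
  proof (cases "W = {0\<^sub>v d}")
    case False
    have "W = carrier_vec d"
    proof (rule full_subspace_if_separated[OF W False])
      fix i j assume ij: "i < d" "j < d" "i \<noteq> j"
      then have "e i \<noteq> e j" by (simp add: e_eq_iff)
      then obtain s where s: "e i s \<noteq> e j s" by blast
      then have sb: "s \<in> arcs b"
        using supp_funs_nonzeroD[OF e_closed[OF ij(1)], of s]
          supp_funs_nonzeroD[OF e_closed[OF ij(2)], of s] by force
      then have bs: "b s \<noteq> 0" by (simp add: arcs_def)
      obtain t where t: "\<theta> (t * ((e i s - e j s) * b s)) \<noteq> 1"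
        using add_char_nontrivial_multiple[OF \<theta>, of "(e i s - e j s) * b s"] s bs by auto
      \<comment> \<open>The only nonzero entry lies at index s + 1, which is not an arc by
        disjointness. So \<open>g\<close> translates nothing and acts diagonally, with eigenvalues
        that differ at \<open>i\<close> and \<open>j\<close> by the choice of
        \<open>t\<close>.\<close>
      define g where "g = superdiagonal n (\<lambda>k. if k = Suc s then t else 0)"
      have g: "g \<in> carrier (unitri n)" by (simp add: g_def)
      have idx: "g $$ (k, Suc k) = (if k = Suc s then t else 0)" if "Suc k < n" for k
        using that by (simp add: g_def)
      have shift: "heis_shift b g v = v" if "v \<in> supp_funs (arcs b)" for v
      proof (rule ext)
        fix k
        show "heis_shift b g v k = v k"
          using that disj sb arcs_lt[of k] idx[of k]
          by (cases "k \<in> arcs b") (auto simp: heis_shift_def supp_funs_def)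
      qed
      have phase: "heis_phase \<theta> n a b g v = \<theta> (band_sum n a b g) * \<theta> (v s * (b s * t))" for v
      proof -
        have "(\<Sum>k\<in>arcs b. v k * (b k * g $$ (Suc k, Suc (Suc k)))) =
            (\<Sum>k\<in>arcs b. if k = s then v s * (b s * t) else 0)"
          using arcs_lt by (intro sum.cong refl) (auto simp: idx)
        then show ?thesis using sb finite_arcs[OF b] by (simp add: heis_phase_def add_char_add[OF \<theta>])
      qed
      have "heis_phase \<theta> n a b g (e i) \<noteq> heis_phase \<theta> n a b g (e j)"
      proof
        assume "heis_phase \<theta> n a b g (e i) = heis_phase \<theta> n a b g (e j)"
        then have "\<theta> (e i s * (b s * t)) = \<theta> (e j s * (b s * t))"
          by (simp add: phase add_char_nonzero[OF \<theta>])
        then have "\<theta> (e i s * (b s * t) - e j s * (b s * t)) = 1"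
          by (simp only: add_char_eq_iff[OF \<theta>, of "e i s * (b s * t)"])
        moreover have "e i s * (b s * t) - e j s * (b s * t) = t * ((e i s - e j s) * b s)"
          by (simp add: algebra_simps)
        ultimately show False using t by simp
      qed
      moreover have "vec d (\<lambda>k. heis_phase \<theta> n a b g (e k) * w $ k) \<in> W" if "w \<in> W" for w
      proof -
        have "w \<in> carrier_vec d" using that W(1) by blast
        then have "vec d (\<lambda>k. heis_phase \<theta> n a b g (e k) * w $ k) = \<rho> g *\<^sub>v w"
          using rep_carrier[of g]
          by (intro eq_vecI) (auto simp: apply_rep shift e_closed simp del: index_mult_mat_vec)
        then show ?thesis using inv[OF g that] by simp
      qed
      ultimately show "\<exists>c. c i \<noteq> c j \<and> (\<forall>w\<in>W. vec d (\<lambda>k. c k * w $ k) \<in> W)"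
        by (intro exI[of _ "\<lambda>k. heis_phase \<theta> n a b g (e k)"]) blast
    next
      fix i j assume ij: "i < d" "j < d" and unit: "unit_vec d i \<in> W"
      \<comment> \<open>Translation by e i - e j takes \<open>e j\<close> to \<open>e i\<close>. The
        operator composes functions with it, so unit vector \<open>i\<close> goes to a multiple of
        unit vector \<open>j\<close>.\<close>
      define g where "g = superdiagonal n (\<lambda>s. e i s - e j s)"
      have g: "g \<in> carrier (unitri n)" by (simp add: g_def)
      have shift: "heis_shift b g v = (\<lambda>s. v s + (e i s - e j s))" if "v \<in> supp_funs (arcs b)" for v
      proof (rule ext)
        fix k
        show "heis_shift b g v k = v k + (e i k - e j k)"
          using that e_closed[OF ij(1)] e_closed[OF ij(2)] arcs_lt[of k]
          by (cases "k \<in> arcs b") (auto simp: heis_shift_def supp_funs_def g_def)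
      qed
      define c where "c = heis_phase \<theta> n a b g (e j)"
      have "\<rho> g *\<^sub>v unit_vec d i = c \<cdot>\<^sub>v unit_vec d j"
      proof (rule eq_vecI)
        fix k assume "k < dim_vec (c \<cdot>\<^sub>v unit_vec d j)"
        then have k: "k < d" by simp
        obtain l where l: "l < d" "e l = heis_shift b g (e k)"
          using e_surj[OF heis_shift_closed] by metis
        have "l = i \<longleftrightarrow> e l = e i" using l(1) ij by (simp add: e_eq_iff)
        also have "\<dots> \<longleftrightarrow> e k = e j"
          unfolding l(2) shift[OF e_closed[OF k]] by (auto simp: fun_eq_iff)
        also have "\<dots> \<longleftrightarrow> k = j" using k ij by (simp add: e_eq_iff)
        finally show "(\<rho> g *\<^sub>v unit_vec d i) $ k = (c \<cdot>\<^sub>v unit_vec d j) $ k"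
          using k l ij by (simp add: apply_rep[OF _ k l] c_def del: index_mult_mat_vec)
      qed (use rep_carrier[of g] in auto)
      then have "c \<cdot>\<^sub>v unit_vec d j \<in> W" using inv[OF g unit] by simp
      moreover have "c \<noteq> 0" by (simp add: c_def heis_phase_def add_char_nonzero[OF \<theta>])
      ultimately show "\<exists>c. c \<noteq> 0 \<and> c \<cdot>\<^sub>v unit_vec d j \<in> W" by blast
    qed
    then show ?thesis ..
  qed simp
qed

end

lemma irreducible_supercharacter_band:
  assumes "arcs b \<inter> Suc ` arcs b = {}"
  shows "supercharacter \<theta> n (band_functional n a b) \<in> irreducible_characters (unitri n)"
proof -
  have "finite (supp_funs (arcs b) :: (nat \<Rightarrow> 'a) set)"
    by (rule finite_supp_funs[OF finite_arcs[OF b]])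
  from ex_bij_betw_nat_finite[OF this]
  obtain e where "bij_betw e {0..<card (supp_funs (arcs b) :: (nat \<Rightarrow> 'a) set)}
      (supp_funs (arcs b) :: (nat \<Rightarrow> 'a) set)"
    by (elim exE)
  then have e: "bij_betw e {..<CARD('a) ^ card (arcs b)} (supp_funs (arcs b))"
    by (simp add: card_supp_funs[OF finite_arcs[OF b]] atLeast0LessThan)
  have "supercharacter \<theta> n (band_functional n a b) =
      restrict (\<lambda>g. mat_trace (heis_rep \<theta> n a b e g)) (carrier (unitri n))"
  proof (rule extensionalityI)
    show "supercharacter \<theta> n (band_functional n a b) \<in> extensional (carrier (unitri n))"
      by (simp add: supercharacter_def)
  qed (simp_all add: trace_heis_rep[OF e])
  then show ?thesis
    unfolding irreducible_characters_def using irreducible_heis_rep[OF e assms] by blast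
qed

end

section \<open>Parametrization of the Heisenberg supercharacters by label pairs\<close>

lemma Heisenberg_supercharacters_eq:
  fixes \<theta> :: "'a::{field,finite} \<Rightarrow> complex"
  assumes \<theta>: "nontrivial_additive_character \<theta>"
  shows "Heisenberg_supercharacters \<theta> n =
    (\<lambda>(a, b). supercharacter \<theta> n (band_functional n a b)) ` label_pairs (n - 1)"
proof (intro equalityI subsetI)
  fix \<chi> assume "\<chi> \<in> Heisenberg_supercharacters \<theta> n"
  then obtain l where l: "l \<in> dual n" and \<chi>: "\<chi> = supercharacter \<theta> n l"
    and irr: "\<chi> \<in> irreducible_characters (unitri n)"
    and ker: "commutator_subgroup (unitri n) (carrier (unitri n))
      (commutator_subgroup (unitri n) (carrier (unitri n)) (carrier (unitri n)))
      \<subseteq> char_kernel (unitri n) \<chi>"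
    by (auto simp: Heisenberg_supercharacters_def supercharacters_def Heisenberg_characters_def)
  obtain a b where a: "a \<in> supp_funs {..<n - 1}" and b: "b \<in> supp_funs {..<n - 2}"
    and lab: "l = band_functional n a b"
    using band_functional_if_lower_central_in_kernel[OF \<theta> l ker[unfolded \<chi>]] by blast
  have disj: "arcs b \<inter> Suc ` arcs b = {}"
    using arcs_nonadjacent_if_irreducible[OF \<theta> b] irr by (simp add: \<chi> lab)
  \<comment> \<open>Erasing \<open>a\<close> on F leaves the supercharacter unchanged, since it is
    supported where the first superdiagonal vanishes on F.\<close>
  define a' where "a' i = (if i \<in> arc_feet b then 0 else a i)" for i
  have "\<chi> = supercharacter \<theta> n (band_functional n a' b)"
  proof (rule extensionalityI)
    show "\<chi> \<in> extensional (carrier (unitri n))"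
      "supercharacter \<theta> n (band_functional n a' b) \<in> extensional (carrier (unitri n))"
      by (simp_all add: \<chi> supercharacter_def)
    fix g :: "'a mat" assume g: "g \<in> carrier (unitri n)"
    have "band_sum n a b g = band_sum n a' b g" if "\<forall>i\<in>arc_feet b. g $$ (i, Suc i) = 0"
      using that by (auto simp: band_sum_def a'_def intro!: sum.cong)
    then show "\<chi> g = supercharacter \<theta> n (band_functional n a' b) g"
      by (simp add: \<chi> lab supercharacter_band[OF \<theta> b g])
  qed
  moreover have "(a', b) \<in> label_pairs (n - 1)"
    using a b disj
    by (auto simp: label_pairs_def supp_funs_def a'_def arc_feet_def arcs_def numeral_2_eq_2)
  ultimately show "\<chi> \<in> (\<lambda>(a, b). supercharacter \<theta> n (band_functional n a b)) ` label_pairs (n - 1)"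
    by auto
next
  fix \<chi> assume "\<chi> \<in> (\<lambda>(a, b). supercharacter \<theta> n (band_functional n a b)) ` label_pairs (n - 1)"
  then obtain a b where ab: "(a, b) \<in> label_pairs (n - 1)"
    and \<chi>: "\<chi> = supercharacter \<theta> n (band_functional n a b)" by auto
  have b: "b \<in> supp_funs {..<n - 2}" and disj: "arcs b \<inter> Suc ` arcs b = {}"
    using ab by (auto simp: label_pairs_def arcs_def numeral_2_eq_2)
  show "\<chi> \<in> Heisenberg_supercharacters \<theta> n"
    unfolding \<chi> Heisenberg_supercharacters_def supercharacters_def Heisenberg_characters_def
    using irreducible_supercharacter_band[OF \<theta> b disj] lower_central_in_kernel[OF \<theta> b]
      band_functional_dual by blast
qed

text \<open>The value at 1 gives q^|S|. Transvections at (i, i + 2) then reveal \<open>b\<close>,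
  and those at (i, i + 1) with i outside F reveal \<open>a\<close> there, while on F it is
  zero.\<close>

lemma inj_on_supercharacter_band:
  fixes \<theta> :: "'a::{field,finite} \<Rightarrow> complex"
  assumes \<theta>: "nontrivial_additive_character \<theta>"
  shows "inj_on (\<lambda>(a, b). supercharacter \<theta> n (band_functional n a b)) (label_pairs (n - 1))"
proof (rule inj_onI, clarify)
  fix a b a' b' :: "nat \<Rightarrow> 'a"
  assume ab: "(a, b) \<in> label_pairs (n - 1)" "(a', b') \<in> label_pairs (n - 1)"
    and eq: "supercharacter \<theta> n (band_functional n a b) = supercharacter \<theta> n (band_functional n a' b')"
  have supp: "a \<in> supp_funs {..<n - 1}" "b \<in> supp_funs {..<n - 2}"
    "a' \<in> supp_funs {..<n - 1}" "b' \<in> supp_funs {..<n - 2}"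
    using ab by (auto simp: label_pairs_def numeral_2_eq_2)
  note char = supercharacter_band[OF \<theta> supp(2)] supercharacter_band[OF \<theta> supp(4)]
  have lt: "Suc i < n" if "i \<in> arc_feet b \<or> i \<in> arc_feet b'" for i
    using arc_feet_subset[OF supp(2)] arc_feet_subset[OF supp(4)] that by auto
  have band_transvection: "band_sum n a b (transvection n i j t) =
      (if j = Suc i then a i * t else if j = Suc (Suc i) then b i * t else 0)"
    if "i < j" "j < n" for a b i j t
    using band_sum_minus_one[OF transvection_closed[OF that(1)], of n a b t]
      band_sum_elementary[OF that, of a b t] by simp
  have q: "CARD('a) ^ card (arcs b) = CARD('a) ^ card (arcs b')"
  proof -
    have "band_sum n a b (1\<^sub>m n) = 0" for a b :: "nat \<Rightarrow> 'a"
      by (auto simp: band_sum_def intro!: sum.neutral)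
    moreover have "1\<^sub>m n $$ (i, Suc i) = (0 :: 'a)" if "i \<in> arc_feet b \<or> i \<in> arc_feet b'" for i
      using lt[OF that] by simp
    ultimately have "(of_nat (CARD('a) ^ card (arcs b)) :: complex) = of_nat (CARD('a) ^ card (arcs b'))"
      using fun_cong[OF eq, of "1\<^sub>m n"] char[OF one_unitri] by (simp add: add_char_zero[OF \<theta>])
    then show ?thesis by (simp only: of_nat_eq_iff)
  qed
  have idx: "transvection n i j t $$ (k, Suc k) = (if k = i \<and> j = Suc k then t else 0)"
    if "Suc k < n" for i j k and t :: 'a
    using that by (auto simp: transvection_def elementary_def)
  have "b = b'"
  proof
    fix i
    show "b i = b' i"
    proof (cases "i < n - 2")
      case True
      show ?thesis
      proof (rule add_char_separates[OF \<theta>])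
        fix t :: 'a
        let ?g = "transvection n i (Suc (Suc i)) t"
        have "?g $$ (k, Suc k) = 0" if "k \<in> arc_feet b \<or> k \<in> arc_feet b'" for k
          by (auto simp: idx[OF lt[OF that]])
        then show "\<theta> (t * b i) = \<theta> (t * b' i)"
          using fun_cong[OF eq, of ?g] True q
          by (simp add: char band_transvection mult.commute[of t])
      qed
    qed (use supp in \<open>auto simp: supp_funs_def\<close>)
  qed
  moreover have "a = a'"
  proof
    fix i
    consider "i \<in> arc_feet b" | "i \<notin> arc_feet b" "i < n - 1" | "\<not> i < n - 1" by blast
    then show "a i = a' i"
    proof cases
      case 1
      then show ?thesis using ab \<open>b = b'\<close> by (auto simp: label_pairs_def arc_feet_def arcs_def)
    next
      case 2
      show ?thesis
      proof (rule add_char_separates[OF \<theta>])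
        fix t :: 'a
        let ?g = "transvection n i (Suc i) t"
        have "?g $$ (k, Suc k) = 0" if "k \<in> arc_feet b" for k
          using 2 that by (auto simp: idx[OF lt[OF disjI1[OF that]]])
        then show "\<theta> (t * a i) = \<theta> (t * a' i)"
          using fun_cong[OF eq, of ?g] 2 \<open>b = b'\<close>
          by (simp add: char band_transvection mult.commute[of t])
      qed
    qed (use supp in \<open>auto simp: supp_funs_def\<close>)
  qed
  ultimately show "a = a' \<and> b = b'" by simp
qed

section \<open>The functional of a path\<close>

lemma start_sum_Cons: "start_sum ((s, ts) # P) (Suc k) = fst s + snd s + start_sum P k"
  by (simp add: start_sum_def endpoint_def)

text \<open>A step functional with the superdiagonals of the matrix replaced by arbitrary sequences,
  so that an induction over the path can shift them.\<close>

definition label_value :: "(nat \<Rightarrow> 'a) \<Rightarrow> (nat \<Rightarrow> 'a) \<Rightarrow> step \<times> 'a::field list \<Rightarrow> nat \<Rightarrow> 'a" where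
  "label_value f1 f2 c d =
     (if fst c = (0, 1) then hd (snd c) * f1 d
      else if fst c = (1, 1) then hd (snd c) * f2 d else 0)"

lemma label_value_Suc:
  "label_value f1 f2 c (Suc d) = label_value (\<lambda>i. f1 (Suc i)) (\<lambda>i. f2 (Suc i)) c d"
  by (simp add: label_value_def)

text \<open>Removing the first step shifts all later positions by its height; the induction absorbs
  this into \<open>f1\<close> and \<open>f2\<close>.\<close>

lemma sum_path_labels:
  fixes f1 f2 :: "nat \<Rightarrow> 'a::field"
  assumes "P \<in> labeled_paths Pell_steps"
  shows "(\<Sum>k<length P. label_value f1 f2 (P ! k) (start_sum P k)) =
    (\<Sum>i<path_height P. short_labels P i * f1 i) + (\<Sum>i<path_height P. long_labels P i * f2 i)"
  using assms
proof (induction P arbitrary: f1 f2 rule: Pell_paths_induct)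
  case (right P)
  from right(2)[of "\<lambda>i. f1 (Suc i)" "\<lambda>i. f2 (Suc i)"] show ?case
    by (simp add: sum.lessThan_Suc_shift label_value_Suc start_sum_Cons label_value_def[of _ _ _ "start_sum _ 0"] del: sum.lessThan_Suc)
next
  case (diagonal t P)
  from diagonal(3)[of "\<lambda>i. f1 (Suc (Suc i))" "\<lambda>i. f2 (Suc (Suc i))"] show ?case
    by (simp add: sum.lessThan_Suc_shift label_value_Suc start_sum_Cons start_sum_def[of _ 0] endpoint_def label_value_def[of _ _ _ 0]
        del: sum.lessThan_Suc)
next
  case (up t P)
  from up(3)[of "\<lambda>i. f1 (Suc i)" "\<lambda>i. f2 (Suc i)"] show ?case
    by (simp add: sum.lessThan_Suc_shift label_value_Suc start_sum_Cons start_sum_def[of _ 0] endpoint_def label_value_def[of _ _ _ 0]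
        del: sum.lessThan_Suc)
qed simp

lemma path_functional_eq:
  fixes P :: "'a::field labeled_path"
  assumes "n \<ge> 1" "P \<in> Pell_paths n"
  shows "path_functional n P = band_functional n (short_labels P) (long_labels P)"
proof -
  have P: "P \<in> labeled_paths Pell_steps" "path_height P = n - 1"
    using assms by (auto simp: Pell_paths_eq)
  \<comment> \<open>Closes the gap between the path height n - 1 and the n - 2 positions of the
    second superdiagonal.\<close>
  have long: "long_labels P i = 0" if "i \<ge> n - 2" for i
    using label_pairs_of_path[OF P(1)] that P(2) by (auto simp: label_pairs_def supp_funs_def)
  have "(\<Sum>k<length P. step_functional n P k X) = band_sum n (short_labels P) (long_labels P) X"
    if X: "X \<in> strictly_upper n" for X
  proof -
    have "(\<Sum>k<length P. step_functional n P k X) = (\<Sum>k<length P.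
        label_value (\<lambda>i. X $$ (i, Suc i)) (\<lambda>i. X $$ (i, Suc (Suc i))) (P ! k) (start_sum P k))"
      using X by (intro sum.cong refl)
        (auto simp: step_functional_def entry_functional_def label_value_def Let_def split: prod.splits)
    also have "\<dots> = (\<Sum>i<n - 1. short_labels P i * X $$ (i, Suc i)) +
        (\<Sum>i<n - 1. long_labels P i * X $$ (i, Suc (Suc i)))"
      using sum_path_labels[OF P(1), of "\<lambda>i. X $$ (i, Suc i)" "\<lambda>i. X $$ (i, Suc (Suc i))"]
      by (simp add: P(2))
    also have "(\<Sum>i<n - 1. long_labels P i * X $$ (i, Suc (Suc i))) =
        (\<Sum>i<n - 2. long_labels P i * X $$ (i, Suc (Suc i)))"
      by (intro sum.mono_neutral_right) (auto simp: long)
    finally show ?thesis by (simp add: band_sum_def)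
  qed
  then show ?thesis
    unfolding path_functional_def band_functional_def by (intro restrict_ext) simp
qed

text \<open>The bijection is composed of the passage from paths to label pairs and the
  parametrization of supercharacters by label pairs; the number of supercharacters is then that of
  labeled paths.\<close>

theorem theorem4p6:
  fixes \<theta> :: "'a::{field,finite} \<Rightarrow> complex" and n :: nat
  assumes "n \<ge> 1"
    and "nontrivial_additive_character \<theta>"
  shows "bij_betw (path_character \<theta> n) (Pell_paths n :: 'a labeled_path set)
           (Heisenberg_supercharacters \<theta> n) \<and>
         int (card (Heisenberg_supercharacters \<theta> n)) =
           poly (Delannoy_poly n) (int CARD('a) - 1)"
proof
  show bij: "bij_betw (path_character \<theta> n) (Pell_paths n) (Heisenberg_supercharacters \<theta> n)"
  proof -
    have "bij_betw (\<lambda>(a, b). supercharacter \<theta> n (band_functional n a b)) (label_pairs (n - 1))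
        (Heisenberg_supercharacters \<theta> n)"
      unfolding bij_betw_def Heisenberg_supercharacters_eq[OF assms(2)]
      using inj_on_supercharacter_band[OF assms(2)] by blast
    from bij_betw_trans[OF bij_betw_labels[OF assms(1)] this] show ?thesis
      by (rule bij_betw_cong[THEN iffD1, rotated])
        (simp add: path_character_def path_functional_eq[OF assms(1)])
  qed
  show "int (card (Heisenberg_supercharacters \<theta> n)) = poly (Delannoy_poly n) (int CARD('a) - 1)"
    unfolding bij_betw_same_card[OF bij, symmetric] by (rule card_Pell_paths[OF assms(1)])
qed

end
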